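(* Let $G=(V=[n],E,(p_{uv})_{(u,v)\in E})$ be an influence graph and $k\in\{2,\dots,n\}$. Let $\pi^{GR}_k$ be the adaptive greedy policy: it selects $k$ seeds in $k$ steps and, at each step, having observed the partial realisation $\psi$ of the previously selected seeds, selects a node $v\in V\setminus dom(\psi)$ maximizing $\mathbb{E}_{\mathbf L}[\sigma_{\mathbf L}(\{v\}\cup dom(\psi))\mid\psi\subseteq\Phi]$. Then $$\sigma(\pi^{GR}_k)\ \ge\ \left(1-\left(1-\frac{1}{2k}\right)^k\right)OPT_A(G,k)\ \ge\ \left(1-\frac1{\sqrt e}\right)OPT_A(G,k).$$
   Context: Independent cascade model: $G$ is a directed graph on $V=[n]$ with activation probabilities $p_{uv}\in[0,1]$. The live-edge graph $\mathbf L\subseteq E$ contains each edge $(u,v)$ independently with probability $p_{uv}$. For $L\subseteq E$, $S\subseteq V$, $\sigma_L(S)$ is the number of nodes reachable (by a directed path of length $\ge0$ in $(V,L)$) from some node of $S$. Myopic feedback: the random realisation is $\Phi(v):=\{v\}\cup\{z:(v,z)\in\mathbf L\}$; a partial realisation $\psi$ is the restriction of $v\mapsto\{v\}\cup\{z:(v,z)\in L\}$ (for some $L\subseteq E$) to a set $dom(\psi)\subseteq V$, and $\psi\subseteq\Phi$ denotes the event that $\Phi(v)=\psi(v)$ for all $v\in dom(\psi)$. An adaptive policy $\pi$ maps partial realisations to a node or STOP; starting from $\psi=\emptyset$, while $\pi(\psi)=v\ne$ STOP it sets $\psi\leftarrow\psi\cup\{(v,\Phi(v))\}$, ending with $\Psi_\pi$;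 $\sigma(\pi):=\mathbb{E}[\sigma_{\mathbf L}(dom(\Psi_\pi))]$, and $|\pi|=k$ means $|dom(\Psi_\pi)|=k$ always. $OPT_A(G,k)$ is the maximum of $\sigma(\pi)$ over adaptive policies with $|\pi|=k$. *)

theory Defs
  imports "HOL-Analysis.Analysis"
begin

text \<open>Independent cascade model on a finite vertex set V with edge set E \<subseteq> V \<times> V
  and activation probabilities p. Live-edge graphs are subsets L of E.\<close>

definition ic_graph :: "'a set \<Rightarrow> ('a \<times> 'a) set \<Rightarrow> ('a \<times> 'a \<Rightarrow> real) \<Rightarrow> bool" where
  "ic_graph V E p \<longleftrightarrow> finite V \<and> E \<subseteq> V \<times> V \<and> (\<forall>e\<in>E. 0 \<le> p e \<and> p e \<le> 1)"

definition live_prob :: "('a \<times> 'a) set \<Rightarrow> ('a \<times> 'a \<Rightarrow> real) \<Rightarrow> ('a \<times> 'a) set \<Rightarrow> real" where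
  "live_prob E p L = (\<Prod>e\<in>L. p e) * (\<Prod>e\<in>E - L. 1 - p e)"

definition sigma_L :: "'a set \<Rightarrow> ('a \<times> 'a) set \<Rightarrow> 'a set \<Rightarrow> nat" where
  "sigma_L V L S = card {v\<in>V. \<exists>s\<in>S. (s, v) \<in> L\<^sup>*}"

text \<open>Myopic feedback: realisation of node v under live-edge graph L.\<close>
definition Phi :: "('a \<times> 'a) set \<Rightarrow> 'a \<Rightarrow> 'a set" where
  "Phi L v = insert v {z. (v, z) \<in> L}"

type_synonym 'a prealis = "'a \<Rightarrow> 'a set option"
type_synonym 'a policy = "'a prealis \<Rightarrow> 'a option"   \<comment> \<open>None = STOP\<close>

definition partial_realisation :: "'a set \<Rightarrow> ('a \<times> 'a) set \<Rightarrow> 'a prealis \<Rightarrow> bool" where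
  "partial_realisation V E \<psi> \<longleftrightarrow>
     (\<exists>L D. L \<subseteq> E \<and> D \<subseteq> V \<and> \<psi> = (\<lambda>v. if v \<in> D then Some (Phi L v) else None))"

definition consistent :: "'a prealis \<Rightarrow> ('a \<times> 'a) set \<Rightarrow> bool" where
  "consistent \<psi> L \<longleftrightarrow> (\<forall>v\<in>dom \<psi>. \<psi> v = Some (Phi L v))"

fun exec :: "'a policy \<Rightarrow> ('a \<times> 'a) set \<Rightarrow> nat \<Rightarrow> 'a prealis" where
  "exec \<pi> L 0 = Map.empty"
| "exec \<pi> L (Suc m) = (let \<psi> = exec \<pi> L m in
      case \<pi> \<psi> of None \<Rightarrow> \<psi> | Some v \<Rightarrow> \<psi>(v \<mapsto> Phi L v))"

definition final :: "'a policy \<Rightarrow> ('a \<times> 'a) set \<Rightarrow> 'a prealis" where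
  "final \<pi> L = exec \<pi> L (LEAST m. \<pi> (exec \<pi> L m) = None)"

definition policy_size :: "'a set \<Rightarrow> ('a \<times> 'a) set \<Rightarrow> 'a policy \<Rightarrow> nat \<Rightarrow> bool" where
  "policy_size V E \<pi> k \<longleftrightarrow>
     (\<forall>L\<subseteq>E. (\<exists>m. \<pi> (exec \<pi> L m) = None)
        \<and> (\<forall>m v. \<pi> (exec \<pi> L m) = Some v \<longrightarrow> v \<in> V)
        \<and> card (dom (final \<pi> L)) = k)"

definition spread :: "'a set \<Rightarrow> ('a \<times> 'a) set \<Rightarrow> ('a \<times> 'a \<Rightarrow> real) \<Rightarrow> 'a policy \<Rightarrow> real" where
  "spread V E p \<pi> = (\<Sum>L\<in>Pow E. live_prob E p L * real (sigma_L V L (dom (final \<pi> L))))"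

definition OPT_A :: "'a set \<Rightarrow> ('a \<times> 'a) set \<Rightarrow> ('a \<times> 'a \<Rightarrow> real) \<Rightarrow> nat \<Rightarrow> real" where
  "OPT_A V E p k = Sup {spread V E p \<pi> | \<pi>. policy_size V E \<pi> k}"

text \<open>Conditional expectation E[sigma_L(S) | \<psi> \<subseteq> \<Phi>] (division by zero gives 0).\<close>
definition cond_exp_spread :: "'a set \<Rightarrow> ('a \<times> 'a) set \<Rightarrow> ('a \<times> 'a \<Rightarrow> real) \<Rightarrow> 'a set \<Rightarrow> 'a prealis \<Rightarrow> real" where
  "cond_exp_spread V E p S \<psi> =
     (\<Sum>L\<in>{L\<in>Pow E. consistent \<psi> L}. live_prob E p L * real (sigma_L V L S))
     / (\<Sum>L\<in>{L\<in>Pow E. consistent \<psi> L}. live_prob E p L)"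

definition greedy_policy :: "'a set \<Rightarrow> ('a \<times> 'a) set \<Rightarrow> ('a \<times> 'a \<Rightarrow> real) \<Rightarrow> nat \<Rightarrow> 'a policy \<Rightarrow> bool" where
  "greedy_policy V E p k \<pi> \<longleftrightarrow>
     (\<forall>\<psi>. partial_realisation V E \<psi> \<longrightarrow>
        (card (dom \<psi>) < k \<longrightarrow>
           (\<exists>v. \<pi> \<psi> = Some v \<and> v \<in> V - dom \<psi> \<and>
              (\<forall>u\<in>V - dom \<psi>. cond_exp_spread V E p (insert u (dom \<psi>)) \<psi>
                               \<le> cond_exp_spread V E p (insert v (dom \<psi>)) \<psi>)))
      \<and> (card (dom \<psi>) = k \<longrightarrow> \<pi> \<psi> = None))"

end

theory Submission
  imports Defs
begin

text \<open>
  The competing policy is compared with the greedy one node by node. For a node \<open>y\<close> let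
  \<open>\<theta> L\<close> be a weighted fraction of the greedy steps before which greedy, run on \<open>L\<close>, already reaches
  \<open>y\<close>. Each seed \<open>s\<close> of the competing policy is charged the price \<open>E[[s reaches y] (1 - \<theta>)]\<close>, computed
  on a live-edge graph independent of all observations. Summed over \<open>y\<close>, the price is a weighted
  average of the expected gains of adding \<open>s\<close> to the greedy seeds, hence at most the same average
  of the greedy gains. A Bellman argument, with the expectation over the unobserved edges of
  \<open>b\<close> applied to the mean of \<open>\<theta>\<close> over fresh copies of the observed edges as potential, bounds the
  probability that the competing policy reaches \<open>y\<close> by \<open>E[b \<theta>] + \<beta> * (expected total price)\<close>.
  Summing over \<open>y\<close> bounds every adaptive policy by
  \<open>\<Sum>i. gain i * (\<beta> k (g i - g (i + 1)) + b (g (i + 1)))\<close>, where \<open>g\<close> are the tail sums of the weights. For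
  suitable \<open>b\<close>, \<open>\<beta>\<close> and \<open>g\<close> every bracket is at most \<open>2.53 - 1 / (2 k)\<close>, which is below the reciprocal
  of \<open>1 - (1 - 1 / (2 k)) ^ k\<close>; this uses \<open>2.53 < 1 / (1 - 1 / sqrt e) = 2.541...\<close>.

  The one-step inequality \<open>OPT - \<sigma> i \<le> 2 k * gain i\<close>, which would give the factor by iteration, fails in
  general: greedy may have reached, with an unobserved outcome, a hub whose few failing edges
  the optimal policy gets to see.
\<close>

section \<open>Expectations over live-edge graphs\<close>

definition ev :: "('a \<times> 'a \<Rightarrow> real) \<Rightarrow> ('a \<times> 'a) set \<Rightarrow> (('a \<times> 'a) set \<Rightarrow> real) \<Rightarrow> real" where
  "ev p X f = (\<Sum>L\<in>Pow X. live_prob X p L * f L)"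

lemma sum_Pow_Un:
  assumes "X \<inter> Y = {}"
  shows "(\<Sum>L\<in>Pow (X \<union> Y). f L) = (\<Sum>A\<in>Pow X. \<Sum>B\<in>Pow Y. f (A \<union> B))"
proof -
  have "bij_betw (\<lambda>(A, B). A \<union> B) (Pow X \<times> Pow Y) (Pow (X \<union> Y))"
    by (rule bij_betw_byWitness[where f' = "\<lambda>L. (L \<inter> X, L \<inter> Y)"]) (use assms in auto)
  then have "(\<Sum>L\<in>Pow (X \<union> Y). f L) = (\<Sum>(A, B)\<in>Pow X \<times> Pow Y. f (A \<union> B))"
    using sum.reindex_bij_betw[of "\<lambda>(A, B). A \<union> B" _ _ f] by (simp add: case_prod_unfold)
  then show ?thesis
    by (simp add: sum.cartesian_product)
qed

text \<open>Independence of disjoint edge sets: the product weight factorises, which gives a Fubini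
  rule. Conditioning on observed edges then means integrating over the unobserved block
  only.\<close>

lemma ev_Un:
  assumes fin: "finite X" "finite Y" and disj: "X \<inter> Y = {}"
  shows "ev p (X \<union> Y) f = ev p X (\<lambda>A. ev p Y (\<lambda>B. f (A \<union> B)))"
proof -
  have "((\<Prod>e\<in>A \<union> B. p e) * (\<Prod>e\<in>(X \<union> Y) - (A \<union> B). 1 - p e)) * f (A \<union> B) =
        ((\<Prod>e\<in>A. p e) * (\<Prod>e\<in>X - A. 1 - p e)) * (((\<Prod>e\<in>B. p e) * (\<Prod>e\<in>Y - B. 1 - p e)) * f (A \<union> B))"
    if "A \<in> Pow X" "B \<in> Pow Y" for A B
  proof -
    have eq: "(X \<union> Y) - (A \<union> B) = (X - A) \<union> (Y - B)"
      using that disj by auto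
    have "(\<Prod>e\<in>A \<union> B. p e) = (\<Prod>e\<in>A. p e) * (\<Prod>e\<in>B. p e)"
      using that fin disj by (intro prod.union_disjoint) (auto intro: finite_subset)
    moreover have "(\<Prod>e\<in>(X - A) \<union> (Y - B). 1 - p e) = (\<Prod>e\<in>X - A. 1 - p e) * (\<Prod>e\<in>Y - B. 1 - p e)"
      using that fin disj by (intro prod.union_disjoint) auto
    ultimately show ?thesis
      by (simp add: eq)
  qed
  then show ?thesis
    unfolding ev_def live_prob_def sum_Pow_Un[OF disj] sum_distrib_left
    by (intro sum.cong refl) (simp add: mult.assoc)
qed

lemma ev_cong: "(\<And>L. L \<subseteq> X \<Longrightarrow> f L = g L) \<Longrightarrow> ev p X f = ev p X g"
  by (simp add: ev_def)

lemma ev_add: "ev p X (\<lambda>L. f L + g L) = ev p X f + ev p X g"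
  by (simp add: ev_def algebra_simps sum.distrib)

lemma ev_diff: "ev p X (\<lambda>L. f L - g L) = ev p X f - ev p X g"
  by (simp add: ev_def algebra_simps sum_subtractf)

lemma ev_cmult: "ev p X (\<lambda>L. c * f L) = c * ev p X f"
  by (simp add: ev_def sum_distrib_left algebra_simps)

lemma ev_sum: "ev p X (\<lambda>L. \<Sum>i\<in>I. f i L) = (\<Sum>i\<in>I. ev p X (f i))"
  unfolding ev_def sum_distrib_left by (rule sum.swap)

lemma ev_singleton: "ev p {e} f = (1 - p e) * f {} + p e * f {e}"
proof -
  have "Pow {e} = {{}, {e}}" by auto
  then show ?thesis by (simp add: ev_def live_prob_def)
qed

lemma ev_const:
  assumes "finite X"
  shows "ev p X (\<lambda>_. c) = c"
  using assms
proof (induction X rule: finite_induct)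
  case empty
  show ?case by (simp add: ev_def live_prob_def)
next
  case (insert e X)
  have "ev p (insert e X) (\<lambda>_. c) = ev p {e} (\<lambda>_. ev p X (\<lambda>_. c))"
    using insert.hyps ev_Un[of "{e}" X p "\<lambda>_. c"] by simp
  then show ?case
    by (simp add: insert.IH ev_singleton algebra_simps)
qed

lemma ev_mono:
  assumes "\<And>e. e \<in> X \<Longrightarrow> 0 \<le> p e \<and> p e \<le> 1" and "\<And>L. L \<subseteq> X \<Longrightarrow> f L \<le> g L"
  shows "ev p X f \<le> ev p X g"
  unfolding ev_def live_prob_def
proof (rule sum_mono)
  fix L assume L: "L \<in> Pow X"
  have "0 \<le> (\<Prod>e\<in>L. p e) * (\<Prod>e\<in>X - L. 1 - p e)"
    using assms(1) L by (intro mult_nonneg_nonneg prod_nonneg) auto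
  then show "(\<Prod>e\<in>L. p e) * (\<Prod>e\<in>X - L. 1 - p e) * f L \<le> (\<Prod>e\<in>L. p e) * (\<Prod>e\<in>X - L. 1 - p e) * g L"
    using assms(2) L by (auto intro!: mult_left_mono)
qed

lemma ev_swap: "ev p X (\<lambda>A. ev q Y (\<lambda>B. f A B)) = ev q Y (\<lambda>B. ev p X (\<lambda>A. f A B))"
  unfolding ev_def sum_distrib_left by (subst sum.swap) (simp add: algebra_simps)

section \<open>Reachability\<close>

definition out :: "('a \<times> 'a) set \<Rightarrow> 'a set \<Rightarrow> ('a \<times> 'a) set" where
  "out E S = {e \<in> E. fst e \<in> S}"

text \<open>Only the part of a path after its last visit to \<open>T\<close> is kept: in the
  induction the path is restarted whenever it leaves a node of \<open>T\<close>.\<close>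

lemma last_exit:
  assumes "x \<in> L\<^sup>* `` T"
  shows "\<exists>t\<in>T. (t, x) \<in> ({e \<in> L. fst e = t} \<union> {e \<in> L. fst e \<notin> T})\<^sup>*"
proof -
  obtain t0 where "(t0, x) \<in> L\<^sup>*" "t0 \<in> T" using assms by auto
  then show ?thesis
  proof (induction rule: rtrancl_induct)
    case base
    then show ?case by auto
  next
    case (step y z)
    then obtain t where t: "t \<in> T" "(t, y) \<in> ({e \<in> L. fst e = t} \<union> {e \<in> L. fst e \<notin> T})\<^sup>*"
      by auto
    show ?case
    proof (cases "y \<in> T")
      case True
      then have "(y, z) \<in> ({e \<in> L. fst e = y} \<union> {e \<in> L. fst e \<notin> T})\<^sup>*"
        using step by auto
      with True show ?thesis by blast
    next
      case False
      then have "(y, z) \<in> {e \<in> L. fst e = t} \<union> {e \<in> L. fst e \<notin> T}"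
        using step by auto
      then show ?thesis using t by (meson rtrancl.rtrancl_into_rtrancl)
    qed
  qed
qed

text \<open>A path from \<open>S\<close> could use an edge of \<open>a\<close> only after reaching
  \<open>v\<close>.\<close>

lemma Image_rtrancl_avoid:
  assumes "v \<notin> L\<^sup>* `` S" and "\<And>e. e \<in> a \<Longrightarrow> fst e = v"
  shows "(L \<union> a)\<^sup>* `` S = L\<^sup>* `` S"
proof
  show "(L \<union> a)\<^sup>* `` S \<subseteq> L\<^sup>* `` S"
  proof
    fix x assume "x \<in> (L \<union> a)\<^sup>* `` S"
    then obtain s where "(s, x) \<in> (L \<union> a)\<^sup>*" "s \<in> S" by auto
    then show "x \<in> L\<^sup>* `` S"
    proof (induction rule: rtrancl_induct)
      case base
      then show ?case by auto
    next
      case (step y z)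
      then have "y \<in> L\<^sup>* `` S" "y \<noteq> v" using assms(1) by auto
      then show ?case using step assms(2) by (auto intro: rtrancl.rtrancl_into_rtrancl)
    qed
  qed
  show "L\<^sup>* `` S \<subseteq> (L \<union> a)\<^sup>* `` S"
    using rtrancl_mono[of L "L \<union> a"] by auto
qed

lemma reach_mono: "L \<subseteq> M \<Longrightarrow> S \<subseteq> T \<Longrightarrow> L\<^sup>* `` S \<subseteq> M\<^sup>* `` T"
  using rtrancl_mono[of L M] by blast

text \<open>After its last exit from \<open>insert v S\<close>, a path to \<open>y\<close> either
  starts at an old seed and uses only \<open>A\<close> and \<open>R\<close>, contrary to the last
  assumption, or starts at \<open>v\<close> and uses only \<open>a\<close> and \<open>R\<close>.
  Hence the new event is independent of the earlier observations \<open>A\<close>.\<close>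

lemma reach_insert_new:
  assumes A: "fst ` A \<subseteq> S" and a: "\<And>e. e \<in> a \<Longrightarrow> fst e = v" and R: "fst ` R \<inter> insert v S = {}"
    and v: "v \<notin> S" and ny: "y \<notin> (A \<union> R)\<^sup>* `` S"
  shows "y \<in> (A \<union> (a \<union> R))\<^sup>* `` insert v S \<longleftrightarrow> y \<in> (a \<union> R)\<^sup>* `` {v}"
proof
  assume "y \<in> (A \<union> (a \<union> R))\<^sup>* `` insert v S"
  from last_exit[OF this] obtain t where t: "t \<in> insert v S"
    "(t, y) \<in> ({e \<in> A \<union> (a \<union> R). fst e = t} \<union> {e \<in> A \<union> (a \<union> R). fst e \<notin> insert v S})\<^sup>*" by blast
  show "y \<in> (a \<union> R)\<^sup>* `` {v}"
  proof (cases "t = v")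
    case True
    then have "{e \<in> A \<union> (a \<union> R). fst e = t} \<union> {e \<in> A \<union> (a \<union> R). fst e \<notin> insert v S} \<subseteq> a \<union> R"
      using A a R v by auto
    then show ?thesis using t True rtrancl_mono by blast
  next
    case False
    then have "{e \<in> A \<union> (a \<union> R). fst e = t} \<union> {e \<in> A \<union> (a \<union> R). fst e \<notin> insert v S} \<subseteq> A \<union> R"
      using A a R v t by fastforce
    then have "(t, y) \<in> (A \<union> R)\<^sup>*" using t rtrancl_mono by blast
    then show ?thesis using ny t False by blast
  qed
next
  assume "y \<in> (a \<union> R)\<^sup>* `` {v}"
  then show "y \<in> (A \<union> (a \<union> R))\<^sup>* `` insert v S"
    using reach_mono[of "a \<union> R" "A \<union> (a \<union> R)" "{v}" "insert v S"] by blast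
qed

section \<open>The price argument for a single node\<close>

text \<open>
  The first inequality is convexity of \<open>b\<close>. The second one says that a graph on which the new seed
  reaches \<open>y\<close> for the first time pays, with its reward \<open>1 - \<beta> (1 - w)\<close>, for lowering its own potential
  and for raising that of the graphs it is averaged with.
\<close>

definition potential_ok :: "(real \<Rightarrow> real) \<Rightarrow> real \<Rightarrow> bool" where
  "potential_ok b \<beta> \<longleftrightarrow> 0 \<le> \<beta> \<and> (\<forall>w\<in>{0..1}. 0 \<le> b w) \<and>
     (\<forall>m\<in>{0..1}. \<exists>s. \<forall>w\<in>{0..1}. b m + s * (w - m) \<le> b w \<and>
        max 0 (b m - 1) + s * (w - m) \<le> b w - 1 + \<beta> * (1 - w))"

definition reached :: "'a \<Rightarrow> 'a set \<Rightarrow> ('a \<times> 'a) set \<Rightarrow> real" where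
  "reached y S L = of_bool (y \<in> L\<^sup>* `` S)"

definition price :: "('a \<times> 'a \<Rightarrow> real) \<Rightarrow> ('a \<times> 'a) set \<Rightarrow> (('a \<times> 'a) set \<Rightarrow> real) \<Rightarrow> 'a \<Rightarrow> 'a \<Rightarrow> real" where
  "price p E \<theta> y s = ev p E (\<lambda>G. reached y {s} G * (1 - \<theta> G))"

text \<open>The indicator \<open>c\<close> tells whether \<open>y\<close> is already reached; then only the future reward remains.\<close>

definition reserve :: "(real \<Rightarrow> real) \<Rightarrow> real \<Rightarrow> real \<Rightarrow> real" where
  "reserve b c w = c * max 0 (b w - 1) + (1 - c) * b w"

text \<open>
  \<open>c\<close> and \<open>c'\<close> indicate whether \<open>y\<close> is reached before and after adding the seed, as functions of the
  edges \<open>a\<close> leaving the seed; the alternatives are: \<open>y\<close> is reached anyway, the seed itself was already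
  reached, or it was not. Observing \<open>a\<close> replaces \<open>w a\<close> by its mean, because the fresh copy of these
  edges is independent of \<open>a\<close>.
\<close>

lemma one_step:
  fixes w Y c c' :: "('a \<times> 'a) set \<Rightarrow> real"
  assumes fin: "finite X" and p: "\<And>e. e \<in> X \<Longrightarrow> 0 \<le> p e \<and> p e \<le> 1"
    and b: "potential_ok b \<beta>"
    and w: "\<And>a. a \<subseteq> X \<Longrightarrow> w a \<in> {0..1}"
    and Y: "\<And>a. a \<subseteq> X \<Longrightarrow> Y a \<in> {0, 1}"
    and alt: "(\<forall>a\<subseteq>X. c a = 1 \<and> c' a = 1) \<or> (\<forall>a\<subseteq>X. c a = Y a \<and> c' a = Y a) \<or>
      (\<forall>a\<subseteq>X. c a = 0 \<and> c' a = Y a)"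
  shows "ev p X (\<lambda>a. c' a + reserve b (c' a) (ev p X w) - \<beta> * (Y a * (1 - w a))) \<le>
         ev p X (\<lambda>a. c a + reserve b (c a) (w a))"
proof -
  define m where "m = ev p X w"
  have "ev p X (\<lambda>_. 0) \<le> m" "m \<le> ev p X (\<lambda>_. 1)"
    unfolding m_def using p w by (intro ev_mono; auto)+
  then have m: "m \<in> {0..1}" by (simp add: ev_const fin)
  obtain s where s: "\<And>v. v \<in> {0..1} \<Longrightarrow> b m + s * (v - m) \<le> b v"
      "\<And>v. v \<in> {0..1} \<Longrightarrow> max 0 (b m - 1) + s * (v - m) \<le> b v - 1 + \<beta> * (1 - v)"
    using b m unfolding potential_ok_def by blast
  have \<beta>: "0 \<le> \<beta>" using b by (simp add: potential_ok_def)
  \<comment> \<open>Deviations from the mean integrate to zero, so it suffices to prove a pointwise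
    inequality with some multiple of \<open>w a - m\<close> added.\<close>
  have mean: "ev p X (\<lambda>a. t * (w a - m)) = 0" for t
    by (simp add: ev_cmult ev_diff ev_const[OF fin] m_def)
  have *: "ev p X (\<lambda>a. c' a + reserve b (c' a) (ev p X w) - \<beta> * (Y a * (1 - w a))) \<le>
         ev p X (\<lambda>a. c a + reserve b (c a) (w a))"
    if "\<And>a. a \<subseteq> X \<Longrightarrow> c' a + reserve b (c' a) m - \<beta> * (Y a * (1 - w a)) + t * (w a - m) \<le>
         c a + reserve b (c a) (w a)" for t
  proof -
    have "ev p X (\<lambda>a. c' a + reserve b (c' a) m - \<beta> * (Y a * (1 - w a))) =
      ev p X (\<lambda>a. (c' a + reserve b (c' a) m - \<beta> * (Y a * (1 - w a))) + t * (w a - m))"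
      by (simp only: ev_add mean add_0_right)
    also have "\<dots> \<le> ev p X (\<lambda>a. c a + reserve b (c a) (w a))"
      using p that by (intro ev_mono) auto
    finally show ?thesis by (simp only: m_def)
  qed
  from alt consider (old) "\<forall>a\<subseteq>X. c a = 1 \<and> c' a = 1" | (active) "\<forall>a\<subseteq>X. c a = Y a \<and> c' a = Y a"
    | (new) "\<forall>a\<subseteq>X. c a = 0 \<and> c' a = Y a" by blast
  then show ?thesis
  proof cases
    case old
    show ?thesis
    proof (rule *[of "if b m \<ge> 1 then s else 0"])
      \<comment> \<open>Once \<open>y\<close> is reached the reserve is
        \<open>max 0 (b w - 1)\<close>; a supporting slope of it at \<open>m\<close> is
        \<open>s\<close> if \<open>b m \<ge> 1\<close> and 0 otherwise.\<close>
      fix a assume a: "a \<subseteq> X"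
      have "0 \<le> \<beta> * (Y a * (1 - w a))" using \<beta> Y[OF a] w[OF a] by auto
      then show "c' a + reserve b (c' a) m - \<beta> * (Y a * (1 - w a)) + (if b m \<ge> 1 then s else 0) * (w a - m)
         \<le> c a + reserve b (c a) (w a)"
        using old a s(1)[OF w[OF a]] by (auto simp: reserve_def)
    qed
  next
    case active
    show ?thesis
    proof (rule *[of s])
      fix a assume a: "a \<subseteq> X"
      show "c' a + reserve b (c' a) m - \<beta> * (Y a * (1 - w a)) + s * (w a - m) \<le> c a + reserve b (c a) (w a)"
      proof -
        have eq: "c a = Y a" "c' a = Y a" using active a by auto
        from Y[OF a] consider "Y a = 0" | "Y a = 1" by auto
        then show ?thesis
        proof cases
          case 1
          then show ?thesis using s(1)[OF w[OF a]] eq by (simp add: reserve_def)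
        next
          case 2
          then show ?thesis using s(2)[OF w[OF a]] eq by (simp add: reserve_def algebra_simps)
        qed
      qed
    qed
  next
    case new
    show ?thesis
    proof (rule *[of s])
      fix a assume a: "a \<subseteq> X"
      show "c' a + reserve b (c' a) m - \<beta> * (Y a * (1 - w a)) + s * (w a - m) \<le> c a + reserve b (c a) (w a)"
      proof -
        have eq: "c a = 0" "c' a = Y a" using new a by auto
        from Y[OF a] consider "Y a = 0" | "Y a = 1" by auto
        then show ?thesis
        proof cases
          case 1
          then show ?thesis using s(1)[OF w[OF a]] eq by (simp add: reserve_def)
        next
          case 2
          then show ?thesis using s(2)[OF w[OF a]] eq by (simp add: reserve_def algebra_simps)
        qed
      qed
    qed
  qed
qed

section \<open>Runs of a policy and the Bellman induction\<close>

definition step :: "'a policy \<Rightarrow> ('a \<times> 'a) set \<Rightarrow> 'a prealis \<Rightarrow> 'a prealis" where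
  "step \<pi> L \<psi> = (case \<pi> \<psi> of None \<Rightarrow> \<psi> | Some v \<Rightarrow> \<psi>(v \<mapsto> Phi L v))"

lemma exec_eq_funpow: "exec \<pi> L m = (step \<pi> L ^^ m) Map.empty"
  by (induction m) (simp_all add: step_def Let_def)

text \<open>Normal form of a partial realisation; every state of a run has it, by
  \<open>exec_eq_obs\<close>.\<close>

definition obs :: "'a set \<Rightarrow> ('a \<times> 'a) set \<Rightarrow> 'a prealis" where
  "obs S A = (\<lambda>v. if v \<in> S then Some (Phi A v) else None)"

lemma dom_obs [simp]: "dom (obs S A) = S"
  by (auto simp: obs_def split: if_splits)

lemma dom_step: "dom \<psi> \<subseteq> dom (step \<pi> L \<psi>)" "finite (dom \<psi>) \<Longrightarrow> finite (dom (step \<pi> L \<psi>))"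
  by (auto simp: step_def split: option.splits)

lemma dom_funpow_step: "dom \<psi> \<subseteq> dom ((step \<pi> L ^^ n) \<psi>)"
proof (induction n)
  case (Suc n)
  then show ?case using dom_step(1)[of "(step \<pi> L ^^ n) \<psi>" \<pi> L] by simp
qed simp

lemma finite_dom_funpow_step: "finite (dom \<psi>) \<Longrightarrow> finite (dom ((step \<pi> L ^^ n) \<psi>))"
  by (induction n) (simp_all add: dom_step(2))

lemma Phi_cong: "(\<And>z. (v, z) \<in> L \<longleftrightarrow> (v, z) \<in> M) \<Longrightarrow> Phi L v = Phi M v"
  by (auto simp: Phi_def)

lemma reached_01: "reached y S L \<in> {0, 1}"
  by (simp add: reached_def)

text \<open>
  The set \<open>A\<close> consists of the live edges leaving the observed nodes \<open>S\<close>, and \<open>R\<close> of the other ones.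
\<close>

lemma bellman:
  fixes E :: "('a \<times> 'a) set"
  assumes fin: "finite E" and p: "\<And>e. e \<in> E \<Longrightarrow> 0 \<le> p e \<and> p e \<le> 1"
    and b: "potential_ok b \<beta>" and \<theta>: "\<And>L. L \<subseteq> E \<Longrightarrow> \<theta> L \<in> {0..1}"
    and S: "finite S" and A: "A \<subseteq> out E S"
  shows "ev p (E - out E S) (\<lambda>R. reached y (dom ((step \<pi> (A \<union> R) ^^ n) (obs S A))) (A \<union> R)
           - \<beta> * (\<Sum>s\<in>dom ((step \<pi> (A \<union> R) ^^ n) (obs S A)) - S. price p E \<theta> y s))
       \<le> ev p (E - out E S) (\<lambda>R. reached y S (A \<union> R)
           + reserve b (reached y S (A \<union> R)) (ev p (out E S) (\<lambda>F. \<theta> (F \<union> R))))"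
  using S A
\<comment> \<open>Backward induction on the number \<open>n\<close> of remaining steps, over all
  observed states; for this reason runs are iterates of \<open>step\<close> from an arbitrary state,
  not only from the empty one.\<close>
proof (induction n arbitrary: S A)
  case 0
  have fO: "finite (out E S)" using fin by (simp add: out_def)
  have "0 \<le> reserve b (reached y S (A \<union> R)) (ev p (out E S) (\<lambda>F. \<theta> (F \<union> R)))"
    if R: "R \<subseteq> E - out E S" for R
  proof -
    have *: "\<theta> (F \<union> R) \<in> {0..1}" if "F \<subseteq> out E S" for F
      using that R by (intro \<theta>) (auto simp: out_def)
    have "ev p (out E S) (\<lambda>_. 0) \<le> ev p (out E S) (\<lambda>F. \<theta> (F \<union> R))"
      "ev p (out E S) (\<lambda>F. \<theta> (F \<union> R)) \<le> ev p (out E S) (\<lambda>_. 1)"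
      using p * by (intro ev_mono; auto simp: out_def)+
    then have "ev p (out E S) (\<lambda>F. \<theta> (F \<union> R)) \<in> {0..1}" by (simp add: ev_const fO)
    then show ?thesis
      using b reached_01[of y S "A \<union> R"] by (auto simp: reserve_def potential_ok_def)
  qed
  then show ?case using p by (intro ev_mono) auto
next
  case (Suc n)
  show ?case
  proof (cases "\<exists>v. \<pi> (obs S A) = Some v \<and> v \<notin> S")
    \<comment> \<open>The policy stops or repeats an observed node, so the state does not
      change.\<close>
    case False
    have "(step \<pi> (A \<union> R) ^^ Suc n) (obs S A) = (step \<pi> (A \<union> R) ^^ n) (obs S A)"
      if R: "R \<subseteq> E - out E S" for R
    proof -
      have "Phi (A \<union> R) v = Phi A v" if "v \<in> S" for v
        using R that by (intro Phi_cong) (auto simp: out_def)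
      then have "step \<pi> (A \<union> R) (obs S A) = obs S A"
        using False by (auto simp: step_def obs_def split: option.splits)
      then show ?thesis by (simp add: funpow_Suc_right del: funpow.simps)
    qed
    then have "ev p (E - out E S) (\<lambda>R. reached y (dom ((step \<pi> (A \<union> R) ^^ Suc n) (obs S A))) (A \<union> R)
           - \<beta> * (\<Sum>s\<in>dom ((step \<pi> (A \<union> R) ^^ Suc n) (obs S A)) - S. price p E \<theta> y s)) =
        ev p (E - out E S) (\<lambda>R. reached y (dom ((step \<pi> (A \<union> R) ^^ n) (obs S A))) (A \<union> R)
           - \<beta> * (\<Sum>s\<in>dom ((step \<pi> (A \<union> R) ^^ n) (obs S A)) - S. price p E \<theta> y s))"
      by (intro ev_cong) simp
    then show ?thesis using Suc.IH[OF Suc.prems] by simp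
  next
    case True
    then obtain v where v: "\<pi> (obs S A) = Some v" "v \<notin> S" by blast
    \<comment> \<open>\<open>X\<close> consists of the edges revealed by the new seed
      \<open>v\<close>, \<open>Z\<close> of those still unobserved afterwards.\<close>
    define X where "X = out E {v}"
    define Z where "Z = E - out E (insert v S)"
    have finX: "finite X" "finite Z" "finite (out E S)" using fin by (auto simp: X_def Z_def out_def)
    have split1: "E - out E S = X \<union> Z" "X \<inter> Z = {}" using v by (auto simp: X_def Z_def out_def)
    have split2: "out E (insert v S) = out E S \<union> X" "out E S \<inter> X = {}" using v by (auto simp: X_def out_def)
    have pX: "\<And>e. e \<in> X \<Longrightarrow> 0 \<le> p e \<and> p e \<le> 1" and pZ: "\<And>e. e \<in> Z \<Longrightarrow> 0 \<le> p e \<and> p e \<le> 1"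
      and pO: "\<And>e. e \<in> out E S \<Longrightarrow> 0 \<le> p e \<and> p e \<le> 1"
      using p by (auto simp: X_def Z_def out_def)
    let ?fin = "\<lambda>n S A R. dom ((step \<pi> (A \<union> R) ^^ n) (obs S A))"
    let ?val = "\<lambda>n S A R. reached y (?fin n S A R) (A \<union> R) - \<beta> * (\<Sum>s\<in>?fin n S A R - S. price p E \<theta> y s)"
    define c' where "c' a R = reached y (insert v S) (A \<union> (a \<union> R))" for a R
    define c where "c a R = reached y S (A \<union> (a \<union> R))" for a R
    define w where "w a R = ev p (out E S) (\<lambda>F. \<theta> (F \<union> (a \<union> R)))" for a R
    define Y where "Y a R = reached y {v} (a \<union> R)" for a R
    \<comment> \<open>Once \<open>X\<close> is observed, its fresh copy enters the mean of
      \<open>\<theta>\<close>, so the potential is taken at the average of \<open>w\<close> over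
      \<open>X\<close>.\<close>
    have wbar: "ev p (out E (insert v S)) (\<lambda>F. \<theta> (F \<union> R)) = ev p X (\<lambda>a. w a R)" for R
      unfolding split2(1) w_def by (subst ev_Un) (use finX split2 in \<open>auto simp: Un_assoc intro: ev_swap\<close>)
    have w01: "w a R \<in> {0..1}" if "a \<subseteq> X" "R \<subseteq> Z" for a R
    proof -
      have *: "\<theta> (F \<union> (a \<union> R)) \<in> {0..1}" if "F \<subseteq> out E S" for F
        using that \<open>a \<subseteq> X\<close> \<open>R \<subseteq> Z\<close> by (intro \<theta>) (auto simp: out_def X_def Z_def)
      have "ev p (out E S) (\<lambda>_. 0) \<le> w a R" "w a R \<le> ev p (out E S) (\<lambda>_. 1)"
        unfolding w_def using pO * by (intro ev_mono; auto)+
      then show ?thesis by (simp add: ev_const finX)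
    qed
    have step1: "?val (Suc n) S A (a \<union> R) = ?val n (insert v S) (A \<union> a) R - \<beta> * price p E \<theta> y v"
      if a: "a \<subseteq> X" and R: "R \<subseteq> Z" for a R
    proof -
      have "Phi (A \<union> (a \<union> R)) u = Phi (A \<union> a) u" if "u \<in> insert v S" for u
        using R that by (intro Phi_cong) (auto simp: Z_def out_def)
      moreover have "Phi (A \<union> a) u = Phi A u" if "u \<in> S" for u
        using a that v by (intro Phi_cong) (auto simp: X_def out_def)
      ultimately have "step \<pi> (A \<union> (a \<union> R)) (obs S A) = obs (insert v S) (A \<union> a)"
        using v by (auto simp: step_def obs_def)
      then have eq: "(step \<pi> (A \<union> (a \<union> R)) ^^ Suc n) (obs S A) =
          (step \<pi> (A \<union> a \<union> R) ^^ n) (obs (insert v S) (A \<union> a))"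
        by (simp add: funpow_Suc_right Un_assoc del: funpow.simps)
      define T where "T = ?fin n (insert v S) (A \<union> a) R"
      have T: "insert v S \<subseteq> T" "finite T"
        using dom_funpow_step[of "obs (insert v S) (A \<union> a)"]
          finite_dom_funpow_step[of "obs (insert v S) (A \<union> a)"] Suc.prems unfolding T_def by auto
      have "(\<Sum>s\<in>T - S. price p E \<theta> y s) = price p E \<theta> y v + (\<Sum>s\<in>T - insert v S. price p E \<theta> y s)"
      proof -
        have TS: "T - S = insert v (T - insert v S)" using T(1) v(2) by blast
        show ?thesis unfolding TS by (rule sum.insert) (use T(2) in blast)+
      qed
      then show ?thesis
        unfolding eq T_def[symmetric] by (simp only: Un_assoc distrib_left diff_diff_eq add.commute)
    qed
    have step2: "ev p Z (\<lambda>R. ?val n (insert v S) (A \<union> a) R)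
        \<le> ev p Z (\<lambda>R. c' a R + reserve b (c' a R) (ev p X (\<lambda>a. w a R)))" if a: "a \<subseteq> X" for a
    proof -
      have "A \<union> a \<subseteq> out E (insert v S)"
        using a Suc.prems by (auto simp: out_def X_def)
      from Suc.IH[OF _ this] Suc.prems show ?thesis
        by (simp add: Z_def[symmetric] wbar c'_def Un_assoc)
    qed
    \<comment> \<open>The price is computed on a whole fresh graph. Removing the fresh copies
      \<open>F\<close> of the observed edges from reachability only lowers it and leaves
      \<open>Y\<close> times the mean of \<open>1 - \<theta>\<close> over \<open>F\<close>.\<close>
    have step3: "ev p X (\<lambda>a. ev p Z (\<lambda>R. Y a R * (1 - w a R))) \<le> price p E \<theta> y v"
    proof -
      have E_eq: "E = out E S \<union> (X \<union> Z)" "out E S \<inter> (X \<union> Z) = {}"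
        using split1 by (auto simp: out_def)
      have "price p E \<theta> y v = ev p (out E S) (\<lambda>F. ev p (X \<union> Z) (\<lambda>B. reached y {v} (F \<union> B) * (1 - \<theta> (F \<union> B))))"
        unfolding price_def by (subst (1) E_eq(1), subst ev_Un) (use finX E_eq(2) in auto)
      also have "\<dots> = ev p (X \<union> Z) (\<lambda>B. ev p (out E S) (\<lambda>F. reached y {v} (F \<union> B) * (1 - \<theta> (F \<union> B))))"
        by (rule ev_swap)
      also have "\<dots> \<ge> ev p (X \<union> Z) (\<lambda>B. ev p (out E S) (\<lambda>F. reached y {v} B * (1 - \<theta> (F \<union> B))))"
      proof (intro ev_mono)
        fix B F assume BF: "B \<subseteq> X \<union> Z" "F \<subseteq> out E S"
        have "\<theta> (F \<union> B) \<in> {0..1}" using BF by (intro \<theta>) (auto simp: out_def X_def Z_def)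
        moreover have "reached y {v} B \<le> reached y {v} (F \<union> B)"
          using reach_mono[of B "F \<union> B" "{v}" "{v}"] by (auto simp: reached_def)
        ultimately show "reached y {v} B * (1 - \<theta> (F \<union> B)) \<le> reached y {v} (F \<union> B) * (1 - \<theta> (F \<union> B))"
          by (intro mult_right_mono) auto
      qed (use pX pZ pO in auto)
      also have "ev p (X \<union> Z) (\<lambda>B. ev p (out E S) (\<lambda>F. reached y {v} B * (1 - \<theta> (F \<union> B)))) =
          ev p (X \<union> Z) (\<lambda>B. reached y {v} B * (1 - ev p (out E S) (\<lambda>F. \<theta> (F \<union> B))))"
        by (simp only: ev_cmult ev_diff ev_const[OF finX(3)])
      also have "\<dots> = ev p X (\<lambda>a. ev p Z (\<lambda>R. Y a R * (1 - w a R)))"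
        unfolding Y_def w_def by (rule ev_Un) (use finX split1 in auto)
      finally show ?thesis .
    qed
    have step4: "ev p X (\<lambda>a. c' a R + reserve b (c' a R) (ev p X (\<lambda>a. w a R)) - \<beta> * (Y a R * (1 - w a R)))
        \<le> ev p X (\<lambda>a. c a R + reserve b (c a R) (w a R))" if R: "R \<subseteq> Z" for R
    proof (rule one_step[OF finX(1) pX b w01[OF _ R]])
      show "Y a R \<in> {0, 1}" for a unfolding Y_def by (rule reached_01)
      have A: "fst ` A \<subseteq> S" using Suc.prems by (auto simp: out_def)
      have a: "fst e = v" if "a \<subseteq> X" "e \<in> a" for a e using that by (auto simp: X_def out_def)
      have R': "fst ` R \<inter> insert v S = {}" using R by (auto simp: Z_def out_def)
      show "(\<forall>a\<subseteq>X. c a R = 1 \<and> c' a R = 1) \<or> (\<forall>a\<subseteq>X. c a R = Y a R \<and> c' a R = Y a R) \<or>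
        (\<forall>a\<subseteq>X. c a R = 0 \<and> c' a R = Y a R)"
      proof (cases "y \<in> (A \<union> R)\<^sup>* `` S")
        case True
        then have "y \<in> (A \<union> (a \<union> R))\<^sup>* `` S" "y \<in> (A \<union> (a \<union> R))\<^sup>* `` insert v S" for a
          using reach_mono[of "A \<union> R" "A \<union> (a \<union> R)" S S]
            reach_mono[of "A \<union> R" "A \<union> (a \<union> R)" S "insert v S"] by blast+
        then show ?thesis by (auto simp: c_def c'_def reached_def)
      next
        case False
        have c'Y: "c' a R = Y a R" if "a \<subseteq> X" for a
          unfolding c'_def Y_def reached_def
          using reach_insert_new[OF A a[OF that] R' v(2) False] by simp
        show ?thesis
        \<comment> \<open>If \<open>v\<close> is already reached, adding it as a seed changes
          nothing; otherwise no path from \<open>S\<close> can use the edges leaving it.\<close>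
        proof (cases "v \<in> (A \<union> R)\<^sup>* `` S")
          case True
          have "c a R = Y a R" if "a \<subseteq> X" for a
          proof -
            have "v \<in> (A \<union> (a \<union> R))\<^sup>* `` S" 
              using True reach_mono[of "A \<union> R" "A \<union> (a \<union> R)" S S] by blast
            then have "y \<in> (A \<union> (a \<union> R))\<^sup>* `` insert v S \<longleftrightarrow> y \<in> (A \<union> (a \<union> R))\<^sup>* `` S"
              by (auto intro: rtrancl_trans)
            then show ?thesis using c'Y[OF that] by (simp add: c_def c'_def reached_def)
          qed
          then show ?thesis using c'Y by blast
        next
          case nv: False
          have "c a R = 0" if "a \<subseteq> X" for a
          proof -
            have "A \<union> (a \<union> R) = (A \<union> R) \<union> a" by auto
            then have "(A \<union> (a \<union> R))\<^sup>* `` S = (A \<union> R)\<^sup>* `` S"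
              using Image_rtrancl_avoid[OF nv, of a] a[OF that] by simp
            then show ?thesis using False by (simp add: c_def reached_def)
          qed
          then show ?thesis using c'Y by blast
        qed
      qed
    qed
    have "ev p (E - out E S) (?val (Suc n) S A) = ev p X (\<lambda>a. ev p Z (\<lambda>R. ?val (Suc n) S A (a \<union> R)))"
      unfolding split1(1) by (rule ev_Un) (use finX split1 in auto)
    also have "\<dots> = ev p X (\<lambda>a. ev p Z (\<lambda>R. ?val n (insert v S) (A \<union> a) R - \<beta> * price p E \<theta> y v))"
      by (rule ev_cong, rule ev_cong, rule step1)
    also have "\<dots> = ev p X (\<lambda>a. ev p Z (\<lambda>R. ?val n (insert v S) (A \<union> a) R)) - \<beta> * price p E \<theta> y v"
      using finX by (simp only: ev_diff ev_const)
    also have "\<dots> \<le> ev p X (\<lambda>a. ev p Z (\<lambda>R. c' a R + reserve b (c' a R) (ev p X (\<lambda>a. w a R))))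
        - \<beta> * ev p X (\<lambda>a. ev p Z (\<lambda>R. Y a R * (1 - w a R)))"
    proof (rule diff_mono)
      show "ev p X (\<lambda>a. ev p Z (\<lambda>R. ?val n (insert v S) (A \<union> a) R))
        \<le> ev p X (\<lambda>a. ev p Z (\<lambda>R. c' a R + reserve b (c' a R) (ev p X (\<lambda>a. w a R))))"
        by (rule ev_mono[OF pX step2])
      show "\<beta> * ev p X (\<lambda>a. ev p Z (\<lambda>R. Y a R * (1 - w a R))) \<le> \<beta> * price p E \<theta> y v"
        using b by (intro mult_left_mono step3) (simp add: potential_ok_def)
    qed
    also have "\<dots> = ev p X (\<lambda>a. ev p Z (\<lambda>R. c' a R + reserve b (c' a R) (ev p X (\<lambda>a. w a R)) - \<beta> * (Y a R * (1 - w a R))))"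
      by (simp only: ev_diff ev_cmult)
    \<comment> \<open>The one-step inequality averages over the new observation with
      \<open>R\<close> fixed, so the two expectations are exchanged, and exchanged back
      afterwards.\<close>
    also have "\<dots> = ev p Z (\<lambda>R. ev p X (\<lambda>a. c' a R + reserve b (c' a R) (ev p X (\<lambda>a. w a R)) - \<beta> * (Y a R * (1 - w a R))))"
      by (rule ev_swap)
    also have "\<dots> \<le> ev p Z (\<lambda>R. ev p X (\<lambda>a. c a R + reserve b (c a R) (w a R)))"
      by (rule ev_mono[OF pZ step4])
    also have "\<dots> = ev p X (\<lambda>a. ev p Z (\<lambda>R. c a R + reserve b (c a R) (w a R)))"
      by (rule ev_swap)
    also have "\<dots> = ev p (E - out E S) (\<lambda>R. reached y S (A \<union> R)
           + reserve b (reached y S (A \<union> R)) (ev p (out E S) (\<lambda>F. \<theta> (F \<union> R))))"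
      unfolding split1(1) c_def w_def by (rule sym, rule ev_Un) (use finX split1 in auto)
    finally show ?thesis .
  qed
qed

text \<open>The Bellman bound at the start: with nothing observed there are no fresh copies, and the
  reserve of the unreached \<open>y\<close> is \<open>b (\<theta> L)\<close>.\<close>

lemma adaptive_bound:
  fixes E :: "('a \<times> 'a) set"
  assumes fin: "finite E" and p: "\<And>e. e \<in> E \<Longrightarrow> 0 \<le> p e \<and> p e \<le> 1"
    and b: "potential_ok b \<beta>" and \<theta>: "\<And>L. L \<subseteq> E \<Longrightarrow> \<theta> L \<in> {0..1}"
  shows "ev p E (\<lambda>L. reached y (dom (exec \<pi> L n)) L)
    \<le> ev p E (\<lambda>L. b (\<theta> L)) + \<beta> * ev p E (\<lambda>L. \<Sum>s\<in>dom (exec \<pi> L n). price p E \<theta> y s)"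
proof -
  have [simp]: "out E {} = {}" "obs {} {} = (Map.empty :: 'a prealis)" by (auto simp: out_def obs_def)
  have [simp]: "reached y {} L = 0" for L by (simp add: reached_def)
  have [simp]: "ev p {} f = f {}" for f by (simp add: ev_def live_prob_def)
  have "ev p (E - out E {}) (\<lambda>R. reached y (dom ((step \<pi> ({} \<union> R) ^^ n) (obs {} {}))) ({} \<union> R)
           - \<beta> * (\<Sum>s\<in>dom ((step \<pi> ({} \<union> R) ^^ n) (obs {} {})) - {}. price p E \<theta> y s))
       \<le> ev p (E - out E {}) (\<lambda>R. reached y {} ({} \<union> R)
           + reserve b (reached y {} ({} \<union> R)) (ev p (out E {}) (\<lambda>F. \<theta> (F \<union> R))))"
    by (rule bellman) (use fin p b \<theta> in auto)
  then show ?thesis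
    by (simp add: exec_eq_funpow[symmetric] reserve_def ev_diff ev_cmult)
qed

section \<open>The greedy policy\<close>

lemma exec_Suc:
  "\<pi> (exec \<pi> L m) = None \<Longrightarrow> exec \<pi> L (Suc m) = exec \<pi> L m"
  "\<pi> (exec \<pi> L m) = Some v \<Longrightarrow> exec \<pi> L (Suc m) = (exec \<pi> L m)(v \<mapsto> Phi L v)"
  by (simp_all add: Let_def)

declare exec.simps(2) [simp del]

lemma dom_exec_Suc: "\<pi> (exec \<pi> L m) = Some v \<Longrightarrow> dom (exec \<pi> L (Suc m)) = insert v (dom (exec \<pi> L m))"
  by (simp only: exec_Suc(2) dom_fun_upd option.distinct if_False)

lemma exec_eq_obs: "exec \<pi> L m = obs (dom (exec \<pi> L m)) L"
proof (induction m)
  case 0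
  show ?case by (simp add: obs_def)
next
  case (Suc m)
  show ?case
  proof (cases "\<pi> (exec \<pi> L m)")
    case None
    then show ?thesis using Suc by (simp add: exec_Suc)
  next
    case (Some v)
    note eq = exec_Suc(2)[where \<pi> = \<pi>, OF Some]
    have "exec \<pi> L (Suc m) = (obs (dom (exec \<pi> L m)) L)(v \<mapsto> Phi L v)"
      unfolding eq using Suc by simp
    also have "\<dots> = obs (insert v (dom (exec \<pi> L m))) L"
      by (auto simp: obs_def)
    also have "insert v (dom (exec \<pi> L m)) = dom (exec \<pi> L (Suc m))"
      unfolding eq by simp
    finally show ?thesis .
  qed
qed

lemma exec_Some:
  assumes "u \<in> dom (exec \<pi> L m)"
  shows "exec \<pi> L m u = Some (Phi L u)"
proof -
  have "exec \<pi> L m u = obs (dom (exec \<pi> L m)) L u" by (rule fun_cong[OF exec_eq_obs])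
  then show ?thesis using assms by (simp add: obs_def)
qed

text \<open>A run depends on the live edges only through what it observes. So the graphs consistent
  with its realisation are exactly those on which the run produces it.\<close>

lemma exec_cong:
  "consistent (exec \<pi> L0 m) L \<Longrightarrow> exec \<pi> L m = exec \<pi> L0 m"
proof (induction m)
  case (Suc m)
  show ?case
  proof (cases "\<pi> (exec \<pi> L0 m)")
    case None
    have "exec \<pi> L m = exec \<pi> L0 m"
      using Suc unfolding exec_Suc(1)[where \<pi> = \<pi>, OF None] by blast
    then show ?thesis
      using exec_Suc(1)[of \<pi> L0 m] exec_Suc(1)[of \<pi> L m] None by (simp only:)
  next
    case (Some v)
    note eq = exec_Suc(2)[where \<pi> = \<pi>, OF Some]
    have cons: "((exec \<pi> L0 m)(v \<mapsto> Phi L0 v)) u = Some (Phi L u)"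
      if "u \<in> insert v (dom (exec \<pi> L0 m))" for u
    proof -
      have "u \<in> dom ((exec \<pi> L0 m)(v \<mapsto> Phi L0 v))" using that by simp
      then show ?thesis using Suc.prems unfolding eq consistent_def by (rule bspec[rotated])
    qed
    have Phi_v: "Phi L0 v = Phi L v" using cons[of v] by simp
    have "consistent (exec \<pi> L0 m) L"
      unfolding consistent_def
    proof
      fix u assume u: "u \<in> dom (exec \<pi> L0 m)"
      show "exec \<pi> L0 m u = Some (Phi L u)"
      \<comment> \<open>The policy may select an observed node again, and then the entry at
        \<open>v\<close> has been overwritten.\<close>
      proof (cases "u = v")
        case True
        then show ?thesis using exec_Some[OF u] Phi_v by simp
      next
        case False
        then show ?thesis using cons[of u] u by simp
      qed
    qed
    then have "exec \<pi> L m = exec \<pi> L0 m" by (rule Suc.IH)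
    then show ?thesis
      using eq exec_Suc(2)[of \<pi> L m v] Some Phi_v by (simp only:)
  qed
qed simp

lemma sigma_L_eq_sum:
  assumes "finite V"
  shows "real (sigma_L V L S) = (\<Sum>y\<in>V. reached y S L)"
proof -
  have "(\<Sum>y\<in>V. reached y S L) = real (card (V \<inter> {v. v \<in> L\<^sup>* `` S}))"
    unfolding reached_def using assms by simp
  moreover have "V \<inter> {v. v \<in> L\<^sup>* `` S} = {v \<in> V. \<exists>s\<in>S. (s, v) \<in> L\<^sup>*}" by auto
  ultimately show ?thesis by (simp add: sigma_L_def)
qed

lemma reached_mono: "S \<subseteq> T \<Longrightarrow> reached y S L \<le> reached y T L"
  using reach_mono[of L L S T] by (auto simp: reached_def)

lemma reached_insert:
  "reached y (insert s D) L - reached y D L = reached y {s} L * (1 - reached y D L)"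
  by (auto simp: reached_def)

text \<open>Let \<open>t\<close> be the first index with \<open>r t = 1\<close>. The weights from
  \<open>t\<close> on telescope to \<open>g t\<close>, and the right-hand side has a single jump, at
  step \<open>t - 1\<close>, contributing \<open>b (g t)\<close>. Without such an index both sides
  vanish because \<open>b 0 = 0\<close>.\<close>

lemma sum_first_hit:
  fixes r g :: "nat \<Rightarrow> real"
  assumes r: "\<And>i. i \<le> k \<Longrightarrow> r i \<in> {0, 1}" "r 0 = 0" "\<And>i. i < k \<Longrightarrow> r i \<le> r (Suc i)"
    and g: "g k = 0" and b: "b 0 = (0::real)"
  shows "b (\<Sum>i<k. (g i - g (Suc i)) * r i) = (\<Sum>i<k. (r (Suc i) - r i) * b (g (Suc i)))"
proof (cases "\<exists>i\<le>k. r i = 1")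
  case False
  then have "r i = 0" if "i \<le> k" for i using r(1)[OF that] that by auto
  then show ?thesis using b by (simp add: Suc_le_eq)
next
  case True
  define t where "t = (LEAST i. i \<le> k \<and> r i = 1)"
  have t: "t \<le> k" "r t = 1"
    unfolding t_def using LeastI_ex[of "\<lambda>i. i \<le> k \<and> r i = 1"] True by auto
  have lt: "r i = 0" if "i < t" for i
    using not_less_Least[of i "\<lambda>i. i \<le> k \<and> r i = 1"] that t r(1)[of i] unfolding t_def by auto
  have ge: "r i = 1" if "t \<le> i" "i \<le> k" for i
    using that
  proof (induction i rule: dec_induct)
    case base
    show ?case by (rule t)
  next
    case (step n)
    then show ?case using r(1)[of "Suc n"] r(3)[of n] by auto
  qed
  obtain u where u: "t = Suc u" using r(2) t by (cases t) auto
  have "(\<Sum>i<k. (g i - g (Suc i)) * r i) = (\<Sum>i=t..<k. g i - g (Suc i))"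
  proof -
    have "(\<Sum>i<k. (g i - g (Suc i)) * r i) = (\<Sum>i=t..<k. (g i - g (Suc i)) * r i)"
      using lt by (intro sum.mono_neutral_right) auto
    then show ?thesis using ge by simp
  qed
  also have "\<dots> = g t - g k" by (rule sum_Suc_diff'[OF t(1), of "\<lambda>i. - g i", simplified]) 
  finally have 1: "(\<Sum>i<k. (g i - g (Suc i)) * r i) = g t" using g by simp
  have "(\<Sum>i<k. (r (Suc i) - r i) * b (g (Suc i))) = (\<Sum>i\<in>{u}. (r (Suc i) - r i) * b (g (Suc i)))"
  proof (rule sum.mono_neutral_right)
    show "\<forall>i\<in>{..<k} - {u}. (r (Suc i) - r i) * b (g (Suc i)) = 0"
    proof
      fix i assume i: "i \<in> {..<k} - {u}"
      then consider "Suc i < t" | "t \<le> i" using u by (cases "i < u") auto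
      then show "(r (Suc i) - r i) * b (g (Suc i)) = 0"
        using i lt ge by cases auto
    qed
  qed (use t u in auto)
  also have "\<dots> = b (g t)" using t u lt[of u] by simp
  finally show ?thesis using 1 by simp
qed

section \<open>Greedy runs, their gains, and the comparison with other policies\<close>

locale greedy_ic =
  fixes V :: "'a set" and E :: "('a \<times> 'a) set" and p :: "'a \<times> 'a \<Rightarrow> real"
    and k :: nat and \<pi> :: "'a policy"
  assumes ic: "ic_graph V E p" and k: "k \<le> card V" and greedy: "greedy_policy V E p k \<pi>"
begin

lemma finV: "finite V" and subE: "E \<subseteq> V \<times> V" and p01: "e \<in> E \<Longrightarrow> 0 \<le> p e \<and> p e \<le> 1"
  using ic by (auto simp: ic_graph_def)

lemma finE: "finite E"
  using subE finV by (meson finite_SigmaI finite_subset)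

lemma live_prob_nonneg: "L \<subseteq> E \<Longrightarrow> 0 \<le> live_prob E p L"
  unfolding live_prob_def using p01 by (intro mult_nonneg_nonneg prod_nonneg) auto

abbreviation seeds :: "nat \<Rightarrow> ('a \<times> 'a) set \<Rightarrow> 'a set" where
  "seeds i L \<equiv> dom (exec \<pi> L i)"

lemma greedy_exec: "L \<subseteq> E \<Longrightarrow> i \<le> k \<Longrightarrow> seeds i L \<subseteq> V \<and> card (seeds i L) = i"
proof (induction i)
  case (Suc i)
  then have IH: "seeds i L \<subseteq> V" "card (seeds i L) = i" by auto
  have "partial_realisation V E (exec \<pi> L i)"
    unfolding partial_realisation_def
    by (intro exI conjI, rule Suc.prems(1), rule IH(1), rule exec_eq_obs[unfolded obs_def])
  moreover have "card (seeds i L) < k" using IH Suc.prems by simp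
  ultimately obtain v where "\<pi> (exec \<pi> L i) = Some v" "v \<in> V - seeds i L"
    using greedy unfolding greedy_policy_def by blast
  then show ?case
    using IH finite_subset[OF IH(1) finV] by (simp add: dom_exec_Suc card_insert_if)
qed simp

lemma realisation_exec: "L \<subseteq> E \<Longrightarrow> i \<le> k \<Longrightarrow> partial_realisation V E (exec \<pi> L i)"
  unfolding partial_realisation_def
  by (intro exI conjI, assumption, erule greedy_exec[THEN conjunct1], assumption, rule exec_eq_obs[unfolded obs_def])

lemma greedy_next:
  assumes "L \<subseteq> E" "i < k"
  obtains v where "\<pi> (exec \<pi> L i) = Some v" "v \<in> V - seeds i L"
    "\<forall>u\<in>V - seeds i L. cond_exp_spread V E p (insert u (seeds i L)) (exec \<pi> L i)
        \<le> cond_exp_spread V E p (insert v (seeds i L)) (exec \<pi> L i)"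
proof -
  have "card (seeds i L) < k" using greedy_exec[of L i] assms by auto
  then have "\<exists>v. \<pi> (exec \<pi> L i) = Some v \<and> v \<in> V - seeds i L \<and>
      (\<forall>u\<in>V - seeds i L. cond_exp_spread V E p (insert u (seeds i L)) (exec \<pi> L i)
        \<le> cond_exp_spread V E p (insert v (seeds i L)) (exec \<pi> L i))"
    using greedy realisation_exec[of L i] assms unfolding greedy_policy_def by simp
  then show thesis using that by blast
qed

lemma greedy_stop: "L \<subseteq> E \<Longrightarrow> \<pi> (exec \<pi> L k) = None"
  using greedy greedy_exec[of L k] realisation_exec[of L k] unfolding greedy_policy_def by auto

lemma final_greedy: "L \<subseteq> E \<Longrightarrow> final \<pi> L = exec \<pi> L k"
proof -
  assume L: "L \<subseteq> E"
  have "(LEAST m. \<pi> (exec \<pi> L m) = None) = k"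
  proof (rule Least_equality)
    fix m assume m: "\<pi> (exec \<pi> L m) = None"
    show "k \<le> m"
    proof (rule ccontr)
      assume "\<not> k \<le> m"
      then show False using greedy_next[OF L, of m] m by auto
    qed
  qed (rule greedy_stop[OF L])
  then show ?thesis by (simp add: final_def)
qed

lemma policy_size_greedy: "policy_size V E \<pi> k"
  unfolding policy_size_def
proof (intro allI impI conjI)
  fix L assume L: "L \<subseteq> E"
  show "\<exists>m. \<pi> (exec \<pi> L m) = None" using greedy_stop[OF L] by blast
  show "card (dom (final \<pi> L)) = k" using greedy_exec[OF L, of k] final_greedy[OF L] by simp
  fix m v assume v: "\<pi> (exec \<pi> L m) = Some v"
  have "m < k"
  proof (rule ccontr)
    assume "\<not> m < k"
    then have "exec \<pi> L m = exec \<pi> L k"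
    proof (induction m)
      case (Suc m)
      then show ?case using greedy_stop[OF L] by (cases "k = Suc m") (auto simp: exec_Suc(1) not_less)
    qed simp
    then show False using v greedy_stop[OF L] by simp
  qed
  then show "v \<in> V" using greedy_next[OF L \<open>m < k\<close>] v by (metis DiffD1 option.inject)
qed

definition sigma :: "'a set \<Rightarrow> ('a \<times> 'a) set \<Rightarrow> real" where
  "sigma S L = (\<Sum>y\<in>V. reached y S L)"

lemma sigma_mono: "S \<subseteq> T \<Longrightarrow> sigma S L \<le> sigma T L"
  unfolding sigma_def by (intro sum_mono reached_mono)

definition gain :: "nat \<Rightarrow> real" where
  "gain i = ev p E (\<lambda>L. sigma (seeds (Suc i) L) L - sigma (seeds i L) L)"

lemma seeds_mono: "seeds i L \<subseteq> seeds (Suc i) L"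
  by (cases "\<pi> (exec \<pi> L i)") (auto simp: exec_Suc(1) dom_exec_Suc)

lemma gain_nonneg: "0 \<le> gain i"
proof -
  have "ev p E (\<lambda>_. 0) \<le> gain i"
    unfolding gain_def using sigma_mono[OF seeds_mono] by (intro ev_mono p01) auto
  then show ?thesis by (simp add: ev_const finE)
qed

text \<open>Graphs are grouped by what greedy observes in its first \<open>i\<close> steps. In each
  group its choice maximises the conditional expectation, hence also the product with the mass of
  the group; summing over groups gives the bound for one \<open>s\<close> common to all of
  them.\<close>

lemma greedy_gain:
  assumes s: "s \<in> V" and i: "i < k"
  shows "ev p E (\<lambda>L. sigma (insert s (seeds i L)) L - sigma (seeds i L) L) \<le> gain i"
proof -
  let ?P = "live_prob E p"
  have "(\<Sum>L\<in>Pow E. ?P L * sigma (insert s (seeds i L)) L) \<le> (\<Sum>L\<in>Pow E. ?P L * sigma (seeds (Suc i) L) L)"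
  proof -
    have grp: "(\<Sum>L\<in>Pow E. f L) = (\<Sum>\<psi>\<in>(\<lambda>L. exec \<pi> L i) ` Pow E. \<Sum>L\<in>{L \<in> Pow E. exec \<pi> L i = \<psi>}. f L)" for f :: "_ \<Rightarrow> real"
      using finE by (intro sum.image_gen) simp
    show ?thesis
      unfolding grp
    proof (rule sum_mono)
      fix \<psi> assume "\<psi> \<in> (\<lambda>L. exec \<pi> L i) ` Pow E"
      then obtain L0 where L0: "L0 \<subseteq> E" "\<psi> = exec \<pi> L0 i" by auto
      define D where "D = dom \<psi>"
      have group: "{L \<in> Pow E. exec \<pi> L i = \<psi>} = {L \<in> Pow E. consistent \<psi> L}" (is "?G = _")
      proof (intro Collect_cong conj_cong refl iffI)
        fix L assume eq: "exec \<pi> L i = \<psi>"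
        show "consistent \<psi> L"
          unfolding consistent_def eq[symmetric] by (intro ballI exec_Some)
      next
        fix L assume "consistent \<psi> L"
        then show "exec \<pi> L i = \<psi>" using exec_cong L0 by metis
      qed
      obtain v where v: "\<pi> (exec \<pi> L0 i) = Some v" "v \<in> V - seeds i L0"
        and max: "\<forall>u\<in>V - seeds i L0. cond_exp_spread V E p (insert u (seeds i L0)) (exec \<pi> L0 i)
          \<le> cond_exp_spread V E p (insert v (seeds i L0)) (exec \<pi> L0 i)"
        using greedy_next[OF L0(1) i] by blast
      note v = v[folded L0(2), folded D_def] and max = max[folded L0(2), folded D_def]
      have D: "seeds i L = D" "seeds (Suc i) L = insert v D" if "L \<in> ?G" for L
        using that v by (auto simp: D_def dom_exec_Suc)
      have nonneg: "0 \<le> ?P L" if "L \<in> ?G" for L using that live_prob_nonneg by auto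
      have "(\<Sum>L\<in>?G. ?P L * sigma (insert s D) L) \<le> (\<Sum>L\<in>?G. ?P L * sigma (insert v D) L)"
      proof (cases "s \<in> D")
        case True
        then have "sigma (insert s D) L \<le> sigma (insert v D) L" for L
          by (intro sigma_mono) auto
        then show ?thesis using nonneg by (intro sum_mono mult_left_mono) auto
      next
        case False
        define den where "den = (\<Sum>L\<in>?G. ?P L)"
        have ce: "cond_exp_spread V E p S \<psi> = (\<Sum>L\<in>?G. ?P L * sigma S L) / den" for S
          unfolding cond_exp_spread_def group den_def sigma_def by (simp add: sigma_L_eq_sum finV)
        have le: "(\<Sum>L\<in>?G. ?P L * sigma (insert s D) L) / den \<le> (\<Sum>L\<in>?G. ?P L * sigma (insert v D) L) / den"
          using max s False unfolding ce by auto
        show ?thesis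
        proof (cases "den = 0")
          \<comment> \<open>On a null group the quotient is 0 by convention and says nothing, but
            all weights in the group vanish.\<close>
          case True
          have "finite ?G" using finE by simp
          then have "?P L = 0" if "L \<in> ?G" for L
            using True nonneg that sum_nonneg_eq_0_iff[of ?G ?P] unfolding den_def by blast
          then show ?thesis by simp
        next
          case False
          moreover have "0 \<le> den" unfolding den_def using nonneg by (rule sum_nonneg)
          ultimately show ?thesis using le by (simp add: divide_le_cancel)
        qed
      qed
      then show "(\<Sum>L\<in>?G. ?P L * sigma (insert s (seeds i L)) L) \<le> (\<Sum>L\<in>?G. ?P L * sigma (seeds (Suc i) L) L)"
        using D by simp
    qed
  qed
  then show ?thesis
    unfolding gain_def ev_diff by (simp add: ev_def)
qed

lemma spread_greedy: "spread V E p \<pi> = (\<Sum>i<k. gain i)"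
proof -
  have "sigma (seeds 0 L) L = 0" for L
    by (simp add: sigma_def reached_def)
  moreover have "(\<Sum>i<k. sigma (seeds (Suc i) L) L - sigma (seeds i L) L) = sigma (seeds k L) L - sigma (seeds 0 L) L" for L
    by (rule sum_lessThan_telescope)
  ultimately have "(\<Sum>i<k. gain i) = ev p E (\<lambda>L. sigma (seeds k L) L)"
    unfolding gain_def ev_sum[symmetric] by simp
  then show ?thesis
    unfolding spread_def ev_def sigma_def by (simp add: sigma_L_eq_sum finV final_greedy)
qed

text \<open>Step \<open>i\<close> of the greedy policy has weight \<open>g i - g (Suc i)\<close>.\<close>

lemma policy_bound:
  assumes size: "policy_size V E \<pi>' k" and b: "potential_ok b \<beta>" "b 0 = 0"
    and g: "g 0 = 1" "g k = 0" "\<And>i. i < k \<Longrightarrow> g (Suc i) \<le> g i"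
  shows "spread V E p \<pi>' \<le> (\<Sum>i<k. gain i * (\<beta> * real k * (g i - g (Suc i)) + b (g (Suc i))))"
proof -
  \<comment> \<open>A common horizon: the sum dominates every single stopping time, and a stopped
    run stays fixed.\<close>
  define n where "n = (\<Sum>L\<in>Pow E. LEAST m. \<pi>' (exec \<pi>' L m) = None)"
  have fin': "final \<pi>' L = exec \<pi>' L n" if L: "L \<subseteq> E" for L
  proof -
    define m0 where "m0 = (LEAST m. \<pi>' (exec \<pi>' L m) = None)"
    have stop: "\<pi>' (exec \<pi>' L m0) = None"
      unfolding m0_def by (rule LeastI_ex) (use size L in \<open>simp add: policy_size_def\<close>)
    have "m0 \<le> n"
      unfolding m0_def n_def using L finE by (intro member_le_sum) auto
    then have "exec \<pi>' L n = exec \<pi>' L m0"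
    proof (induction rule: dec_induct)
      case (step j)
      then show ?case using exec_Suc(1)[of \<pi>' L j] stop by simp
    qed simp
    then show ?thesis by (simp add: final_def m0_def)
  qed
  let ?T = "\<lambda>L. dom (exec \<pi>' L n)"
  have T: "?T L \<subseteq> V" "card (?T L) = k" if L: "L \<subseteq> E" for L
  proof -
    show "card (?T L) = k" using size L unfolding fin'[OF L, symmetric] policy_size_def by blast
    have "dom (exec \<pi>' L m) \<subseteq> V" for m
    proof (induction m)
      case (Suc m)
      have "\<And>v. \<pi>' (exec \<pi>' L m) = Some v \<Longrightarrow> v \<in> V" using size L by (simp add: policy_size_def)
      then show ?case using Suc by (cases "\<pi>' (exec \<pi>' L m)") (simp_all add: exec_Suc(1) dom_exec_Suc)
    qed simp
    then show "?T L \<subseteq> V" .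
  qed
  define lam where "lam i = g i - g (Suc i)" for i
  have lam: "0 \<le> lam i" if "i < k" for i using g(3)[OF that] by (simp add: lam_def)
  have lam1: "(\<Sum>i<k. lam i) = 1"
    using sum_lessThan_telescope'[of g k] g(1,2) by (simp add: lam_def)
  define \<theta> where "\<theta> y L = (\<Sum>i<k. lam i * reached y (seeds i L) L)" for y L
  have \<theta>01: "\<theta> y L \<in> {0..1}" for y L
  proof -
    have "0 \<le> \<theta> y L" unfolding \<theta>_def using lam by (intro sum_nonneg) (auto simp: reached_def)
    moreover have "\<theta> y L \<le> (\<Sum>i<k. lam i)"
      unfolding \<theta>_def using lam by (intro sum_mono) (auto simp: reached_def)
    ultimately show ?thesis using lam1 by simp
  qed
  define M where "M = (\<Sum>i<k. lam i * gain i)"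
  \<comment> \<open>Since the weights sum to 1, \<open>1 - \<theta>\<close> averages the indicators
    that \<open>y\<close> is not yet reached. Summed over \<open>y\<close>, the price becomes the
    average marginal gain of \<open>s\<close>, to which \<open>greedy_gain\<close> applies.\<close>
  have price: "(\<Sum>y\<in>V. price p E (\<theta> y) y s) \<le> M" if s: "s \<in> V" for s
  proof -
    have 1: "1 - \<theta> y G = (\<Sum>i<k. lam i * (1 - reached y (seeds i G) G))" for y G
      by (simp add: \<theta>_def algebra_simps sum_subtractf lam1)
    have "(\<Sum>y\<in>V. reached y {s} G * (1 - \<theta> y G)) =
        (\<Sum>i<k. lam i * (sigma (insert s (seeds i G)) G - sigma (seeds i G) G))" for G
    proof -
      have "(\<Sum>y\<in>V. reached y {s} G * (1 - \<theta> y G)) =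
        (\<Sum>y\<in>V. \<Sum>i<k. lam i * (reached y (insert s (seeds i G)) G - reached y (seeds i G) G))"
        unfolding 1 reached_insert by (simp add: sum_distrib_left mult.left_commute)
      also have "\<dots> = (\<Sum>i<k. \<Sum>y\<in>V. lam i * (reached y (insert s (seeds i G)) G - reached y (seeds i G) G))"
        by (rule sum.swap)
      finally show ?thesis
        by (simp add: sigma_def sum_distrib_left sum_subtractf algebra_simps)
    qed
    note eq = this
    have "(\<Sum>y\<in>V. price p E (\<theta> y) y s) = ev p E (\<lambda>G. \<Sum>y\<in>V. reached y {s} G * (1 - \<theta> y G))"
      unfolding price_def by (rule ev_sum[symmetric])
    also have "\<dots> = ev p E (\<lambda>G. \<Sum>i<k. lam i * (sigma (insert s (seeds i G)) G - sigma (seeds i G) G))"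
      unfolding eq ..
    also have "\<dots> = (\<Sum>i<k. lam i * ev p E (\<lambda>G. sigma (insert s (seeds i G)) G - sigma (seeds i G) G))"
      by (simp only: ev_sum ev_cmult)
    also have "\<dots> \<le> M"
      unfolding M_def using greedy_gain[OF s] lam by (intro sum_mono mult_left_mono) auto
    finally show ?thesis .
  qed
  \<comment> \<open>If greedy first reaches \<open>y\<close> in step \<open>i\<close>, then
    \<open>\<theta> y L = g (Suc i)\<close>, so \<open>b (\<theta> y L)\<close> is booked on the
    increment of that step.\<close>
  have first: "(\<Sum>y\<in>V. b (\<theta> y L)) = (\<Sum>i<k. (sigma (seeds (Suc i) L) L - sigma (seeds i L) L) * b (g (Suc i)))" for L
  proof -
    have "b (\<theta> y L) = (\<Sum>i<k. (reached y (seeds (Suc i) L) L - reached y (seeds i L) L) * b (g (Suc i)))" for y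
      unfolding \<theta>_def lam_def
    proof (rule sum_first_hit)
      show "reached y (seeds i L) L \<in> {0, 1}" for i by (rule reached_01)
      show "reached y (seeds 0 L) L = 0" by (simp add: reached_def)
      show "reached y (seeds i L) L \<le> reached y (seeds (Suc i) L) L" for i
        by (rule reached_mono[OF seeds_mono])
    qed (fact g(2), fact b(2))
    then have "(\<Sum>y\<in>V. b (\<theta> y L)) =
      (\<Sum>i<k. \<Sum>y\<in>V. (reached y (seeds (Suc i) L) L - reached y (seeds i L) L) * b (g (Suc i)))"
      by (simp only:) (rule sum.swap)
    then show ?thesis
      by (simp only: sigma_def sum_subtractf[symmetric] sum_distrib_right)
  qed
  have "spread V E p \<pi>' = ev p E (\<lambda>L. \<Sum>y\<in>V. reached y (?T L) L)"
    unfolding spread_def ev_def by (simp add: sigma_L_eq_sum finV fin')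
  also have "\<dots> \<le> (\<Sum>y\<in>V. ev p E (\<lambda>L. b (\<theta> y L)) + \<beta> * ev p E (\<lambda>L. \<Sum>s\<in>?T L. price p E (\<theta> y) y s))"
    unfolding ev_sum by (rule sum_mono, rule adaptive_bound[OF finE p01 b(1) \<theta>01])
  also have "\<dots> = ev p E (\<lambda>L. \<Sum>y\<in>V. b (\<theta> y L)) + \<beta> * ev p E (\<lambda>L. \<Sum>s\<in>?T L. \<Sum>y\<in>V. price p E (\<theta> y) y s)"
  proof -
    have "(\<Sum>y\<in>V. ev p E (\<lambda>L. b (\<theta> y L)) + \<beta> * ev p E (\<lambda>L. \<Sum>s\<in>?T L. price p E (\<theta> y) y s)) =
      (\<Sum>y\<in>V. ev p E (\<lambda>L. b (\<theta> y L))) + \<beta> * (\<Sum>y\<in>V. ev p E (\<lambda>L. \<Sum>s\<in>?T L. price p E (\<theta> y) y s))"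
      by (simp only: sum.distrib sum_distrib_left)
    also have "(\<Sum>y\<in>V. ev p E (\<lambda>L. b (\<theta> y L))) = ev p E (\<lambda>L. \<Sum>y\<in>V. b (\<theta> y L))"
      by (rule ev_sum[symmetric])
    also have "(\<Sum>y\<in>V. ev p E (\<lambda>L. \<Sum>s\<in>?T L. price p E (\<theta> y) y s)) =
      ev p E (\<lambda>L. \<Sum>y\<in>V. \<Sum>s\<in>?T L. price p E (\<theta> y) y s)"
      by (rule ev_sum[symmetric])
    also have "\<dots> = ev p E (\<lambda>L. \<Sum>s\<in>?T L. \<Sum>y\<in>V. price p E (\<theta> y) y s)"
      by (rule ev_cong) (rule sum.swap)
    finally show ?thesis .
  qed
  also have "\<dots> \<le> (\<Sum>i<k. gain i * b (g (Suc i))) + \<beta> * (real k * M)"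
  proof (rule add_mono)
    have "ev p E (\<lambda>L. \<Sum>y\<in>V. b (\<theta> y L)) = (\<Sum>i<k. b (g (Suc i)) * gain i)"
      unfolding first gain_def by (subst mult.commute) (simp only: ev_sum ev_cmult)
    then show "ev p E (\<lambda>L. \<Sum>y\<in>V. b (\<theta> y L)) \<le> (\<Sum>i<k. gain i * b (g (Suc i)))"
      by (simp add: mult.commute)
    have "ev p E (\<lambda>L. \<Sum>s\<in>?T L. \<Sum>y\<in>V. price p E (\<theta> y) y s) \<le> ev p E (\<lambda>_. real k * M)"
    proof (rule ev_mono[OF p01])
      fix L assume L: "L \<subseteq> E"
      have "(\<Sum>s\<in>?T L. \<Sum>y\<in>V. price p E (\<theta> y) y s) \<le> (\<Sum>s\<in>?T L. M)"
        using T(1)[OF L] by (intro sum_mono price) auto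
      then show "(\<Sum>s\<in>?T L. \<Sum>y\<in>V. price p E (\<theta> y) y s) \<le> real k * M" using T(2)[OF L] by simp
    qed
    then show "\<beta> * ev p E (\<lambda>L. \<Sum>s\<in>?T L. \<Sum>y\<in>V. price p E (\<theta> y) y s) \<le> \<beta> * (real k * M)"
      using b(1) by (intro mult_left_mono) (auto simp: ev_const finE potential_ok_def)
  qed
  also have "\<dots> = (\<Sum>i<k. gain i * (\<beta> * real k * (g i - g (Suc i)) + b (g (Suc i))))"
    by (simp add: M_def lam_def sum_distrib_left sum.distrib[symmetric] algebra_simps)
  finally show ?thesis .
qed

end

section \<open>Choice of the potential and of the weights\<close>

lemma exp_lower: "0 \<le> x \<Longrightarrow> (\<Sum>m<n. x ^ m / fact m) \<le> exp (x::real)"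
proof -
  assume x: "0 \<le> x"
  obtain t where "exp x = (\<Sum>m<n. x ^ m / fact m) + exp t / fact n * x ^ n"
    using Maclaurin_exp_le[of x n] by blast
  then show ?thesis using x by simp
qed

text \<open>A Taylor polynomial of \<open>exp (- x)\<close> with an even number of terms has a
  nonnegative remainder, so it is a lower bound, which is then inverted.\<close>

lemma exp_upper:
  assumes "0 \<le> x" "1 \<le> y * (\<Sum>m<2 * n. (- x) ^ m / fact m)" "0 \<le> y"
  shows "exp (x::real) \<le> y"
proof -
  let ?S = "\<Sum>m<2 * n. (- x) ^ m / fact m"
  obtain t where "exp (- x) = ?S + exp t / fact (2 * n) * (- x) ^ (2 * n)"
    using Maclaurin_exp_le[of "- x" "2 * n"] by blast
  then have "?S \<le> exp (- x)" by simp
  then have "y * ?S \<le> y * exp (- x)" using assms(3) by (intro mult_left_mono)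
  then have "1 \<le> y * exp (- x)" using assms(2) by linarith
  then show ?thesis by (simp add: exp_minus field_simps)
qed

lemma exp_1_bounds: "2718 / 1000 \<le> exp (1::real)" "exp (1::real) \<le> 27184 / 10000"
  using exp_lower[of 1 8] exp_upper[of 1 "27184 / 10000" 5]
  by (simp_all add: eval_nat_numeral)

lemma ln_5_upper: "ln 5 \<le> (16275 / 10000 :: real)"
proof -
  have "5 \<le> exp (16275 / 10000 :: real)"
    using exp_lower[of "16275 / 10000" 9] by (simp add: eval_nat_numeral)
  then show ?thesis using ln_le_cancel_iff[of 5 "exp (16275 / 10000)"] by simp
qed

lemma ln_387: "ln (387 / 100) \<le> (1356 / 1000 :: real)" "254 / 1000 \<le> ln 5 - ln (387 / 100 :: real)"
proof -
  have "387 / 100 \<le> exp (1356 / 1000 :: real)"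
    using exp_lower[of "1356 / 1000" 8] by (simp add: eval_nat_numeral)
  then show "ln (387 / 100) \<le> (1356 / 1000 :: real)"
    using ln_le_cancel_iff[of "387 / 100" "exp (1356 / 1000)"] by simp
  have "exp (254 / 1000) \<le> (500 / 387 :: real)"
    using exp_upper[of "254 / 1000" "500 / 387" 3] by (simp add: eval_nat_numeral)
  then have "254 / 1000 \<le> ln (500 / 387 :: real)"
    using ln_le_cancel_iff[of "exp (254 / 1000)" "500 / 387"] by simp
  also have "ln (500 / 387) = ln 5 - ln (387 / 100 :: real)"
    using ln_div[of 5 "387 / 100"] by simp
  finally show "254 / 1000 \<le> ln 5 - ln (387 / 100 :: real)" .
qed

text \<open>The ratio of the two logarithms is compared with \<open>67 / 50\<close> through integer
  powers. \<open>43 / 5\<close> is the factor by which the exponential in \<open>low_phase\<close>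
  decays up to \<open>switch\<close>.\<close>

lemma ln_86: "ln (43 / 5) \<le> 67 / 50 * ln (5 :: real)" "211 / 100 \<le> ln (43 / 5 :: real)"
proof -
  have "50 * ln (43 / 5 :: real) = ln ((43 / 5) ^ 50)" by (subst ln_realpow) auto
  also have "\<dots> \<le> ln (5 ^ 67)" by (subst ln_le_cancel_iff) (auto simp: power_divide)
  also have "\<dots> = 67 * ln 5" by (subst ln_realpow) auto
  finally show "ln (43 / 5) \<le> 67 / 50 * ln (5 :: real)" by simp
  have "exp (211 / 100) \<le> (43 / 5 :: real)"
    using exp_upper[of "211 / 100" "43 / 5" 5] by (simp add: eval_nat_numeral)
  then show "211 / 100 \<le> ln (43 / 5 :: real)"
    using ln_le_cancel_iff[of "exp (211 / 100)" "43 / 5"] by simp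
qed

text \<open>\<open>439 / 160\<close> is the decay factor of the exponential in
  \<open>high_phase\<close> from \<open>switch\<close> to 1.\<close>

lemma ln_274: "1 \<le> ln (439 / 160 :: real)" "ln (439 / 160) \<le> (1018 / 1000 :: real)"
proof -
  show "1 \<le> ln (439 / 160 :: real)"
    using exp_1_bounds(2) ln_le_cancel_iff[of "exp 1" "439 / 160"] by simp
  have "439 / 160 \<le> exp (1018 / 1000 :: real)"
    using exp_lower[of "1018 / 1000" 8] by (simp add: eval_nat_numeral)
  then show "ln (439 / 160) \<le> (1018 / 1000 :: real)"
    using ln_le_cancel_iff[of "439 / 160" "exp (1018 / 1000)"] by simp
qed

section \<open>The potential\<close>

definition pot_rate :: real where "pot_rate = 10 / 7 * ln 5"

text \<open>
  With an exponential lower branch the slopes can be compared with the potential by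
  \<open>x \<le> exp (x - 1)\<close>, taken at \<open>x = pot_rate * (w - m)\<close>; no such comparison is needed once the potential
  exceeds 1, so the upper branch may be linear. The constants were found by numerical optimisation.
\<close>

definition pot :: "real \<Rightarrow> real" where
  "pot w = (if w \<le> 7 / 10 then 4 / 15 * (exp (pot_rate * w) - 1) else 16 / 15 + 31 / 10 * (w - 7 / 10))"

text \<open>The value 5 at \<open>7 / 10\<close> makes the branches of \<open>pot\<close> meet at
  \<open>16 / 15\<close>; \<open>2325 / 1000\<close> is the largest rate for which the slope there,
  \<open>4 / 15 * pot_rate * 5\<close>, does not exceed \<open>31 / 10\<close>.\<close>

lemma pot_rate: "0 < pot_rate" "pot_rate \<le> 2325 / 1000" "exp (pot_rate * 7 / 10) = 5" "exp pot_rate \<le> 997 / 100"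
proof -
  show "0 < pot_rate" "pot_rate \<le> 2325 / 1000" "exp (pot_rate * 7 / 10) = 5"
    using ln_5_upper by (simp_all add: pot_rate_def)
  have "exp pot_rate ^ 7 = exp (10 * ln 5)"
    by (simp add: pot_rate_def exp_of_nat_mult[symmetric])
  also have "\<dots> = 5 ^ 10"
    using exp_of_nat_mult[of 10 "ln 5 :: real"] by simp
  also have "\<dots> \<le> (997 / 100 :: real) ^ 7" by (simp add: power_divide)
  finally show "exp pot_rate \<le> 997 / 100" by (rule power_le_imp_le_base[of _ 6, simplified]) simp
qed

lemma exp_tangent: "exp x * (1 + (y - x)) \<le> exp (y :: real)"
proof -
  have "exp x * (1 + (y - x)) \<le> exp x * exp (y - x)"
    by (intro mult_left_mono) (use exp_ge_add_one_self[of "y - x"] in auto)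
  then show ?thesis by (simp add: exp_add[symmetric])
qed

text \<open>Rearranged, \<open>q * exp (pot_rate * w)\<close> must lie above the line from
  \<open>- 7 / 30\<close> at 0 to \<open>49 / 60\<close> at \<open>7 / 10\<close>. It lies above its
  tangent, taken where the exponential is \<open>387 / 100\<close> because the slope there is close
  to that of the line; the two lines are compared at both ends.\<close>

lemma lower_region:
  assumes "0 \<le> w" "w \<le> 7 / 10"
  shows "4 / 15 * exp (pot_rate * w - 1) \<le> 4 / 15 * (exp (pot_rate * w) - 1) - 1 + 3 / 2 * (1 - w)"
proof -
  define q :: real where "q = 4 / 15 * (1 - exp (- 1))"
  define t where "t = w / (7 / 10)"
  have t: "0 \<le> t" "t \<le> 1" using assms by (auto simp: t_def)
  have "10000 / 27184 \<le> exp (- 1 :: real)" "exp (- 1 :: real) \<le> 1000 / 2718"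
    using exp_1_bounds by (auto simp: exp_minus field_simps)
  then have q: "16853 / 100000 \<le> q" "q \<le> 16858 / 100000" by (auto simp: q_def)
  let ?l = "ln (387 / 100 :: real)"
  have p0: "- (7 / 30) \<le> q * (387 / 100) * (1 - ?l)"
  proof -
    have "q * (387 / 100) * (?l - 1) \<le> (16858 / 100000) * (387 / 100) * (356 / 1000)"
      using q ln_387(1) by (intro order.trans[OF mult_left_mono[of "?l - 1" "356 / 1000"]] mult_right_mono) auto
    then show ?thesis by (simp add: algebra_simps)
  qed
  have p1: "49 / 60 \<le> q * (387 / 100) * (1 + ln 5 - ?l)"
  proof -
    have "(16853 / 100000) * (387 / 100) * (1254 / 1000) \<le> q * (387 / 100) * (1 + ln 5 - ?l)"
      using q ln_387(2) by (intro mult_mono) auto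
    then show ?thesis by simp
  qed
  have "(1 - t) * (- (7 / 30)) + t * (49 / 60) \<le>
      (1 - t) * (q * (387 / 100) * (1 - ?l)) + t * (q * (387 / 100) * (1 + ln 5 - ?l))"
    using t p0 p1 by (intro add_mono mult_left_mono) auto
  also have "\<dots> = q * (exp ?l * (1 + (pot_rate * w - ?l)))"
    by (simp add: t_def pot_rate_def field_simps)
  also have "\<dots> \<le> q * exp (pot_rate * w)"
    using q by (intro mult_left_mono exp_tangent) auto
  finally have "(1 - t) * (- (7 / 30)) + t * (49 / 60) \<le> q * exp (pot_rate * w)" .
  moreover have "exp (pot_rate * w - 1) = exp (pot_rate * w) * exp (- 1)"
    by (simp add: exp_add[symmetric])
  ultimately show ?thesis
    by (simp add: q_def t_def field_simps)
qed

lemma slope_bound: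
  assumes m: "0 \<le> m" "m \<le> 7 / 10" and w: "0 \<le> w" "w \<le> 1"
  shows "4 / 15 * pot_rate * exp (pot_rate * m) * (w - m) \<le> pot w - 1 + 3 / 2 * (1 - w)"
proof -
  define S where "S = 4 / 15 * pot_rate * exp (pot_rate * m)"
  have sup: "S * (v - m) \<le> 4 / 15 * exp (pot_rate * v - 1)" for v
  proof -
    have "pot_rate * (v - m) \<le> exp (pot_rate * (v - m) - 1)"
      using exp_ge_add_one_self[of "pot_rate * (v - m) - 1"] by simp
    then have "exp (pot_rate * m) * (pot_rate * (v - m)) \<le> exp (pot_rate * m) * exp (pot_rate * (v - m) - 1)"
      by (intro mult_left_mono) auto
    then show ?thesis by (simp add: S_def exp_add[symmetric] algebra_simps)
  qed
  have low: "S * (v - m) \<le> 4 / 15 * (exp (pot_rate * v) - 1) - 1 + 3 / 2 * (1 - v)" if "0 \<le> v" "v \<le> 7 / 10" for v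
    using sup[of v] lower_region[OF that] by linarith
  show ?thesis
  proof (cases "w \<le> 7 / 10")
    case True
    then show ?thesis using low[of w] w by (simp add: pot_def S_def)
  next
    case False
    \<comment> \<open>Beyond \<open>7 / 10\<close> both sides are affine in \<open>w\<close>;
      \<open>31 / 60\<close> and \<open>299 / 300\<close> are the values of the right-hand side at
      \<open>7 / 10\<close> and at 1.\<close>
    have 1: "S * (7 / 10 - m) \<le> 31 / 60" using low[of "7 / 10"] by (simp add: pot_rate(3))
    have "exp (pot_rate - 1) \<le> (997 / 100) / (2718 / 1000)"
      unfolding exp_diff using pot_rate(4) exp_1_bounds(1) by (intro frac_le) auto
    then have 2: "S * (1 - m) \<le> 299 / 300" using sup[of 1] by simp
    have "(1 - w) * (S * (7 / 10 - m)) + (w - 7 / 10) * (S * (1 - m)) \<le> (1 - w) * (31 / 60) + (w - 7 / 10) * (299 / 300)"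
      using 1 2 w False by (intro add_mono mult_left_mono) auto
    moreover have "(1 - w) * (S * (7 / 10 - m)) + (w - 7 / 10) * (S * (1 - m)) = 3 / 10 * (S * (w - m))"
      by (simp add: field_simps)
    moreover have "pot w = 16 / 15 + 31 / 10 * (w - 7 / 10)" using False by (simp add: pot_def)
    moreover from this have "(1 - w) * (31 / 60) + (w - 7 / 10) * (299 / 300) = 3 / 10 * (pot w - 1 + 3 / 2 * (1 - w))"
      by (simp add: field_simps)
    ultimately have "3 / 10 * (S * (w - m)) \<le> 3 / 10 * (pot w - 1 + 3 / 2 * (1 - w))" by simp
    then show ?thesis unfolding S_def[symmetric] by (rule mult_left_le_imp_le) simp
  qed
qed

lemma pot_at: "pot (7 / 10) = 16 / 15"
  by (simp add: pot_def pot_rate(3))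

text \<open>The witness is the slope of the branch containing \<open>m\<close>; \<open>pot\<close>
  is convex because the slope increases at the joint. Where the maximum is \<open>pot m - 1\<close>,
  the second inequality follows from the first; where it is 0, from
  \<open>slope_bound\<close>.\<close>

lemma potential_ok_pot: "potential_ok pot (3 / 2)"
  unfolding potential_ok_def
proof (intro conjI ballI)
  fix w :: real assume w: "w \<in> {0..1}"
  then show "0 \<le> pot w" using pot_rate(1) by (simp add: pot_def)
next
  fix m :: real assume m: "m \<in> {0..1}"
  have slope: "4 / 15 * pot_rate * 5 \<le> 31 / 10" using pot_rate(2) by simp
  have tangent: "4 / 15 * (exp (pot_rate * u) - 1) + 4 / 15 * pot_rate * exp (pot_rate * u) * (v - u) \<le> 4 / 15 * (exp (pot_rate * v) - 1)" for u v
  proof -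
    have "4 / 15 * (exp (pot_rate * u) - 1) + 4 / 15 * pot_rate * exp (pot_rate * u) * (v - u) =
        4 / 15 * (exp (pot_rate * u) * (1 + (pot_rate * v - pot_rate * u))) - 4 / 15"
      by (simp add: field_simps)
    then show ?thesis using exp_tangent[of "pot_rate * u" "pot_rate * v"] by simp
  qed
  show "\<exists>s. \<forall>w\<in>{0..1}. pot m + s * (w - m) \<le> pot w \<and>
        max 0 (pot m - 1) + s * (w - m) \<le> pot w - 1 + 3 / 2 * (1 - w)"
  proof (cases "m \<le> 7 / 10")
    case True
    define S where "S = 4 / 15 * pot_rate * exp (pot_rate * m)"
    have "exp (pot_rate * m) \<le> exp (pot_rate * (7 / 10))" using True pot_rate(1) by simp
    then have "4 / 15 * pot_rate * exp (pot_rate * m) \<le> 4 / 15 * pot_rate * 5"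
      using pot_rate(1,3) by (intro mult_left_mono) auto
    then have S: "S \<le> 31 / 10" using slope by (simp add: S_def)
    have sub: "pot m + S * (w - m) \<le> pot w" if w: "w \<in> {0..1}" for w
    proof (cases "w \<le> 7 / 10")
      case True
      then show ?thesis using tangent[of m w] \<open>m \<le> 7 / 10\<close> by (simp add: pot_def S_def)
    next
      case False
      have "pot m + S * (7 / 10 - m) \<le> 16 / 15"
        using tangent[of m "7 / 10"] \<open>m \<le> 7 / 10\<close> by (simp add: pot_def S_def pot_rate(3))
      moreover have "S * (w - 7 / 10) \<le> 31 / 10 * (w - 7 / 10)"
        using S False by (intro mult_right_mono) auto
      moreover have "S * (w - m) = S * (7 / 10 - m) + S * (w - 7 / 10)" by (simp add: algebra_simps)
      moreover have "pot w = 16 / 15 + 31 / 10 * (w - 7 / 10)" using False by (simp add: pot_def)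
      ultimately show ?thesis by linarith
    qed
    have "max 0 (pot m - 1) + S * (w - m) \<le> pot w - 1 + 3 / 2 * (1 - w)" if w: "w \<in> {0..1}" for w
    proof -
      have "S * (w - m) \<le> pot w - 1 + 3 / 2 * (1 - w)" "0 \<le> 3 / 2 * (1 - w)"
        using slope_bound[of m w] m w True by (auto simp: S_def)
      moreover have "max 0 (a - 1) + x \<le> c - 1 + r" if "x \<le> c - 1 + r" "0 \<le> r" "a + x \<le> c" for a x c r :: real
        using that by (simp add: max_def)
      ultimately show ?thesis using sub[OF w] by blast
    qed
    then show ?thesis using sub by blast
  next
    case False
    have sub: "pot m + 31 / 10 * (w - m) \<le> pot w" if w: "w \<in> {0..1}" for w
    proof (cases "w \<le> 7 / 10")
      case True
      have "31 / 10 * (w - 7 / 10) \<le> 4 / 15 * pot_rate * 5 * (w - 7 / 10)"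
        using slope True by (intro mult_right_mono_neg) auto
      moreover have "16 / 15 + 4 / 15 * pot_rate * 5 * (w - 7 / 10) \<le> pot w"
        using tangent[of "7 / 10" w] True by (simp add: pot_def pot_rate(3))
      ultimately have "16 / 15 + 31 / 10 * (w - 7 / 10) \<le> pot w"
        by (rule order.trans[OF add_left_mono])
      moreover have "pot m + 31 / 10 * (w - m) = 16 / 15 + 31 / 10 * (w - 7 / 10)"
        using False by (simp add: pot_def field_simps)
      ultimately show ?thesis by simp
    qed (use False in \<open>simp add: pot_def field_simps\<close>)
    have "1 \<le> pot m" using False by (simp add: pot_def field_simps)
    then have "max 0 (pot m - 1) + 31 / 10 * (w - m) \<le> pot w - 1 + 3 / 2 * (1 - w)" if w: "w \<in> {0..1}" for w
    proof -
      have "0 \<le> 3 / 2 * (1 - w)" "max 0 (pot m - 1) = pot m - 1" using w \<open>1 \<le> pot m\<close> by auto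
      then show ?thesis using sub[OF w] by linarith
    qed
    then show ?thesis using sub by blast
  qed
qed simp

text \<open>
  For \<open>H = \<beta> * G\<close> and \<open>F = pot \<circ> G\<close> this bounds the bracket of the weights sampled from \<open>G\<close> at
  step size \<open>1 / k\<close>. The quadratic term yields the \<open>- 1 / (2 k)\<close> without which small \<open>k\<close> would fail.
\<close>

definition admissible :: "real \<Rightarrow> (real \<Rightarrow> real) \<Rightarrow> (real \<Rightarrow> real) \<Rightarrow> real \<Rightarrow> real \<Rightarrow> bool" where
  "admissible C H F a b \<longleftrightarrow> (\<forall>s t. a \<le> s \<longrightarrow> s \<le> t \<longrightarrow> t \<le> b \<longrightarrow>
     t - s \<le> F t - F s \<and> H t - H s \<le> (C - F s) * (t - s) - (t - s)\<^sup>2 / 2)"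

text \<open>As \<open>F\<close> grows at rate at least 1,
  \<open>H' x \<le> C - F s - (x - s)\<close> for \<open>x\<close> between \<open>s\<close> and
  \<open>t\<close>; integration yields the quadratic term.\<close>

lemma admissible_deriv:
  assumes F: "\<And>x. a \<le> x \<Longrightarrow> x \<le> b \<Longrightarrow> (F has_real_derivative F' x) (at x) \<and> 1 \<le> F' x"
    and H: "\<And>x. a \<le> x \<Longrightarrow> x \<le> b \<Longrightarrow> (H has_real_derivative H' x) (at x) \<and> H' x \<le> C - F x"
  shows "admissible C H F a b"
  unfolding admissible_def
proof (intro allI impI conjI)
  fix s t assume st: "a \<le> s" "s \<le> t" "t \<le> b"
  have F_grow: "x - s \<le> F x - F s" if x: "s \<le> x" "x \<le> t" for x
  proof -
    have "F s - s \<le> F x - x"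
    proof (rule DERIV_nonneg_imp_nondecreasing[OF x(1)])
      fix y assume y: "s \<le> y" "y \<le> x"
      have "((\<lambda>y. F y - y) has_real_derivative F' y - 1) (at y)"
        using F[of y] y st x by (auto intro!: derivative_eq_intros)
      then show "\<exists>d. ((\<lambda>y. F y - y) has_real_derivative d) (at y) \<and> 0 \<le> d"
        using F[of y] y st x by auto
    qed
    then show ?thesis by simp
  qed
  then show "t - s \<le> F t - F s" using st by simp
  let ?\<psi> = "\<lambda>x. (C - F s) * (x - s) - (x - s)\<^sup>2 / 2 - H x"
  have "?\<psi> s \<le> ?\<psi> t"
  proof (rule DERIV_nonneg_imp_nondecreasing[OF st(2)])
    fix y assume y: "s \<le> y" "y \<le> t"
    have "(?\<psi> has_real_derivative (C - F s) - (y - s) - H' y) (at y)"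
      using H[of y] y st by (auto intro!: derivative_eq_intros simp: field_simps)
    moreover have "0 \<le> (C - F s) - (y - s) - H' y"
      using H[of y] F_grow[OF y] y st by auto
    ultimately show "\<exists>d. (?\<psi> has_real_derivative d) (at y) \<and> 0 \<le> d" by blast
  qed
  then show "H t - H s \<le> (C - F s) * (t - s) - (t - s)\<^sup>2 / 2" by simp
qed

text \<open>The cross term \<open>(m - s) * (t - m)\<close> of the square comes from the growth of
  \<open>F\<close> on the first piece.\<close>

lemma admissible_join:
  assumes 1: "admissible C H F a m" and 2: "admissible C H F m b"
  shows "admissible C H F a b"
  unfolding admissible_def
proof (intro allI impI)
  fix s t assume st: "a \<le> s" "s \<le> t" "t \<le> b"
  show "t - s \<le> F t - F s \<and> H t - H s \<le> (C - F s) * (t - s) - (t - s)\<^sup>2 / 2"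
  proof (cases "t \<le> m \<or> m \<le> s")
    case True
    then show ?thesis using 1 2 st unfolding admissible_def by blast
  next
    case False
    then have l: "m - s \<le> F m - F s" "H m - H s \<le> (C - F s) * (m - s) - (m - s)\<^sup>2 / 2"
      and r: "t - m \<le> F t - F m" "H t - H m \<le> (C - F m) * (t - m) - (t - m)\<^sup>2 / 2"
      using 1 2 st unfolding admissible_def by auto
    have "(C - F m) * (t - m) \<le> (C - F s - (m - s)) * (t - m)"
      using l False by (intro mult_right_mono) auto
    then have "H t - H s \<le> (C - F s) * (m - s) - (m - s)\<^sup>2 / 2 + (C - F s - (m - s)) * (t - m) - (t - m)\<^sup>2 / 2"
      using l r by linarith
    also have "\<dots> = (C - F s) * (t - s) - (t - s)\<^sup>2 / 2"
      by (simp add: field_simps power2_eq_square)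
    finally show ?thesis using l r by simp
  qed
qed

lemma admissible_cong:
  "(\<And>x. a \<le> x \<Longrightarrow> x \<le> b \<Longrightarrow> F x = F' x \<and> H x = H' x) \<Longrightarrow> admissible C H F a b = admissible C H' F' a b"
  unfolding admissible_def by (intro iff_allI imp_cong refl) auto

text \<open>
  Up to rounding of the constants, \<open>schedule\<close> solves \<open>3 / 2 * G' = 253 / 100 - pot G\<close>, \<open>G 0 = 0\<close>, \<open>G 1 = 1\<close>; its argument is
  the remaining fraction of the \<open>k\<close> steps. The equation becomes linear in \<open>low_phase = exp (- pot_rate * G)\<close>
  on the lower branch of \<open>pot\<close> and in \<open>high_phase = pot G\<close> on the upper one.
\<close>

definition switch :: real where "switch = 507 / 1000"
text \<open>The rates are fixed by end values: \<open>low_phase\<close> falls from 1 to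
  \<open>1 / 5\<close> on \<open>[0, switch]\<close>, taking \<open>schedule\<close> from 0 to
  \<open>7 / 10\<close>, and \<open>high_phase\<close> rises from \<open>16 / 15\<close> at
  \<open>switch\<close> to \<open>599 / 300 = pot 1\<close> at 1.\<close>

definition low_rate :: real where "low_rate = ln (43 / 5) / switch"
definition low_phase :: "real \<Rightarrow> real" where "low_phase s = 9 / 95 + 86 / 95 * exp (- (low_rate * s))"
definition high_rate :: real where "high_rate = ln (439 / 160) / (1 - switch)"
definition high_phase :: "real \<Rightarrow> real" where "high_phase s = 253 / 100 - 439 / 300 * exp (- (high_rate * (s - switch)))"
definition schedule :: "real \<Rightarrow> real" where
  "schedule s = (if s \<le> switch then - (7 / 10 * ln (low_phase s) / ln 5) else 7 / 10 + 10 / 31 * (high_phase s - 16 / 15))"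

section \<open>Verification of the schedule\<close>

lemma low_rate: "0 < low_rate" "exp (- (low_rate * switch)) = 5 / 43"
  using ln_86(2) by (auto simp: low_rate_def switch_def exp_minus)

lemma low_phase_bounds: "0 \<le> s \<Longrightarrow> s \<le> switch \<Longrightarrow> 1 / 5 \<le> low_phase s \<and> low_phase s \<le> 1"
proof -
  assume s: "0 \<le> s" "s \<le> switch"
  have "exp (- (low_rate * switch)) \<le> exp (- (low_rate * s))" "exp (- (low_rate * s)) \<le> 1"
    using s low_rate(1) by simp_all
  then show ?thesis unfolding low_rate(2) low_phase_def by linarith
qed

lemma low_phase_switch: "low_phase switch = 1 / 5"
  unfolding low_phase_def low_rate(2) by simp

lemma high_rate: "0 < high_rate" "exp (- (high_rate * (1 - switch))) = 160 / 439" "1 \<le> high_rate * (8 / 15)" "high_rate \<le> 62 / 30"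
  using ln_274 by (auto simp: high_rate_def switch_def exp_minus field_simps)

lemma high_phase_bounds: "switch \<le> s \<Longrightarrow> s \<le> 1 \<Longrightarrow> 8 / 15 \<le> 253 / 100 - high_phase s"
proof -
  assume s: "switch \<le> s" "s \<le> 1"
  have "exp (- (high_rate * (1 - switch))) \<le> exp (- (high_rate * (s - switch)))"
    using s high_rate(1) by simp
  then show ?thesis unfolding high_rate(2) by (simp add: high_phase_def)
qed

lemma high_phase_switch: "high_phase switch = 16 / 15" "high_phase 1 = 599 / 300"
  using high_rate(2) by (simp_all add: high_phase_def)

lemma pot_schedule_low: "0 \<le> s \<Longrightarrow> s \<le> switch \<Longrightarrow> pot (schedule s) = 4 / 15 * (1 / low_phase s - 1)"
proof -
  assume s: "0 \<le> s" "s \<le> switch"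
  have E: "1 / 5 \<le> low_phase s" "0 < low_phase s" using low_phase_bounds[OF s] by auto
  have "ln (1 / 5) \<le> ln (low_phase s)" using E by simp
  then have "- ln 5 \<le> ln (low_phase s)" by (simp add: ln_div)
  then have "schedule s \<le> 7 / 10" using s by (simp add: schedule_def field_simps)
  moreover have "exp (pot_rate * schedule s) = 1 / low_phase s"
    using s E by (simp add: pot_rate_def schedule_def exp_minus field_simps)
  ultimately show ?thesis by (simp add: pot_def)
qed

lemma schedule_switch: "schedule switch = 7 / 10"
  by (simp add: schedule_def low_phase_switch ln_div)

lemma schedule_up: "switch \<le> s \<Longrightarrow> schedule s = 7 / 10 + 10 / 31 * (high_phase s - 16 / 15)"
  by (cases "s = switch") (simp_all add: schedule_switch high_phase_switch, simp add: schedule_def)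

lemma pot_schedule_up: "switch \<le> s \<Longrightarrow> pot (schedule s) = high_phase s"
proof -
  assume s: "switch \<le> s"
  have "exp (- (high_rate * (s - switch))) \<le> 1" using s high_rate(1) by simp
  then have F: "16 / 15 \<le> high_phase s" unfolding high_phase_def by linarith
  show ?thesis
  proof (cases "high_phase s = 16 / 15")
    case True
    then have "schedule s = 7 / 10" using schedule_up[OF s] by (simp only:) simp
    then show ?thesis unfolding True by (simp only: pot_at)
  next
    case False
    then show ?thesis using schedule_up[OF s] F by (simp add: pot_def field_simps)
  qed
qed

lemma admissible_low: "admissible (253 / 100) (\<lambda>s. 3 / 2 * schedule s) (\<lambda>s. pot (schedule s)) 0 switch"
proof -
  have "admissible (253 / 100) (\<lambda>s. - (105 / 100 * ln (low_phase s) / ln 5)) (\<lambda>s. 4 / 15 * (1 / low_phase s - 1)) 0 switch"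
  proof (rule admissible_deriv)
    fix x assume x: "0 \<le> x" "x \<le> switch"
    define e where "e = low_phase x"
    have e: "1 / 5 \<le> e" "e \<le> 1" "0 < e" using low_phase_bounds[OF x] by (auto simp: e_def)
    have dE: "(low_phase has_real_derivative - low_rate * (e - 9 / 95)) (at x)"
    proof -
      have "((\<lambda>s. 9 / 95 + 86 / 95 * exp (- (low_rate * s))) has_real_derivative - low_rate * (e - 9 / 95)) (at x)"
        by (auto intro!: derivative_eq_intros simp: e_def low_phase_def)
      moreover have "low_phase = (\<lambda>s. 9 / 95 + 86 / 95 * exp (- (low_rate * s)))"
        by (rule ext) (rule low_phase_def)
      ultimately show ?thesis by (simp only:)
    qed
    have "((\<lambda>s. 4 / 15 * (1 / low_phase s - 1)) has_real_derivative 4 / 15 * low_rate * ((e - 9 / 95) / e\<^sup>2)) (at x)"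
      by (rule DERIV_cong[OF DERIV_cmult[OF DERIV_diff[OF DERIV_divide[OF DERIV_const dE] DERIV_const]]])
        (use e in \<open>simp_all add: e_def[symmetric] power2_eq_square\<close>)
    moreover have "1 \<le> 4 / 15 * low_rate * ((e - 9 / 95) / e\<^sup>2)"
    proof -
      \<comment> \<open>The quotient is smallest at \<open>e = 1\<close>, that is at
        \<open>x = 0\<close>.\<close>
      have "0 \<le> (1 - e) * (86 * e - 9)" using e by (intro mult_nonneg_nonneg) auto
      then have "86 / 95 \<le> (e - 9 / 95) / e\<^sup>2"
        using e by (subst pos_le_divide_eq) (simp_all add: algebra_simps power2_eq_square)
      then have "4 / 15 * low_rate * (86 / 95) \<le> 4 / 15 * low_rate * ((e - 9 / 95) / e\<^sup>2)"
        using low_rate(1) by (intro mult_left_mono) auto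
      moreover have "1 \<le> 4 / 15 * low_rate * (86 / 95)" using ln_86(2) by (simp add: low_rate_def switch_def)
      ultimately show ?thesis by (rule order.trans[rotated])
    qed
    ultimately show "((\<lambda>s. 4 / 15 * (1 / low_phase s - 1)) has_real_derivative 4 / 15 * low_rate * ((e - 9 / 95) / e\<^sup>2)) (at x)
        \<and> 1 \<le> 4 / 15 * low_rate * ((e - 9 / 95) / e\<^sup>2)" by blast
    have "((\<lambda>s. - (105 / 100 * ln (low_phase s) / ln 5)) has_real_derivative
        105 / 100 * low_rate / ln 5 * ((e - 9 / 95) / e)) (at x)"
    proof -
      have "((\<lambda>s. ln (low_phase s)) has_real_derivative 1 / low_phase x * (- low_rate * (e - 9 / 95))) (at x)"
        using e(3) unfolding e_def by (intro DERIV_chain2[OF DERIV_ln_divide] dE[unfolded e_def])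
      from DERIV_cmult[OF this, of "- (105 / 100 / ln 5)"]
      have "((\<lambda>s. - (105 / 100 / ln 5) * ln (low_phase s)) has_real_derivative
          - (105 / 100 / ln 5) * (1 / low_phase x * (- low_rate * (e - 9 / 95)))) (at x)" .
      moreover have "- (105 / 100 / ln 5) * (1 / low_phase x * (- low_rate * (e - 9 / 95))) =
          105 / 100 * low_rate / ln 5 * ((e - 9 / 95) / e)"
        by (simp add: e_def)
      moreover have "(\<lambda>s. - (105 / 100 / ln 5) * ln (low_phase s)) = (\<lambda>s. - (105 / 100 * ln (low_phase s) / ln 5))"
        by (simp add: fun_eq_iff)
      ultimately show ?thesis by (simp only:)
    qed
    moreover have "105 / 100 * low_rate / ln 5 * ((e - 9 / 95) / e) \<le> 253 / 100 - 4 / 15 * (1 / low_phase x - 1)"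
    proof -
      have "105 / 100 * low_rate / ln 5 \<le> 277515 / 100000"
      proof -
        have "ln (43 / 5) / ln 5 \<le> (67 / 50 :: real)" using ln_86(1) by (simp add: pos_divide_le_eq)
        moreover have "105 / 100 * low_rate / ln 5 = 1050 / 507 * (ln (43 / 5) / ln 5)"
          by (simp add: low_rate_def switch_def)
        ultimately show ?thesis by linarith
      qed
      then have "105 / 100 * low_rate / ln 5 * ((e - 9 / 95) / e) \<le> 277515 / 100000 * ((e - 9 / 95) / e)"
        using e by (intro mult_right_mono) auto
      \<comment> \<open>The inequality is affine in \<open>1 / e\<close>, which ranges over
        \<open>[1, 5]\<close>.\<close>
      also have "\<dots> \<le> 253 / 100 - 4 / 15 * (1 / e - 1)"
      proof -
        have "1 \<le> 1 / e" "1 / e \<le> 5" "(e - 9 / 95) / e = 1 - 9 / 95 * (1 / e)"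
          using e by (auto simp: field_simps)
        moreover have "277515 / 100000 * (1 - 9 / 95 * z) \<le> 253 / 100 - 4 / 15 * (z - 1)"
          if "1 \<le> z" "z \<le> 5" for z :: real
          using that by (simp add: field_simps)
        ultimately show ?thesis by metis
      qed
      finally show ?thesis by (simp add: e_def)
    qed
    ultimately show "((\<lambda>s. - (105 / 100 * ln (low_phase s) / ln 5)) has_real_derivative
        105 / 100 * low_rate / ln 5 * ((e - 9 / 95) / e)) (at x) \<and>
        105 / 100 * low_rate / ln 5 * ((e - 9 / 95) / e) \<le> 253 / 100 - 4 / 15 * (1 / low_phase x - 1)" by blast
  qed
  then show ?thesis
    by (subst admissible_cong[where F' = "\<lambda>s. 4 / 15 * (1 / low_phase s - 1)" and H' = "\<lambda>s. - (105 / 100 * ln (low_phase s) / ln 5)"])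
      (intro conjI, erule (1) pot_schedule_low, simp add: schedule_def)
qed

text \<open>Here both derivatives are multiples of \<open>253 / 100 - high_phase\<close>, which is
  at least \<open>8 / 15\<close>, so the two conditions reduce to
  \<open>15 / 8 \<le> high_rate \<le> 31 / 15\<close>.\<close>

lemma admissible_up: "admissible (253 / 100) (\<lambda>s. 3 / 2 * schedule s) (\<lambda>s. pot (schedule s)) switch 1"
proof -
  have "admissible (253 / 100) (\<lambda>s. 3 / 2 * (7 / 10 + 10 / 31 * (high_phase s - 16 / 15))) high_phase switch 1"
  proof (rule admissible_deriv)
    fix x assume x: "switch \<le> x" "x \<le> 1"
    have dF: "(high_phase has_real_derivative high_rate * (253 / 100 - high_phase x)) (at x)"
    proof -
      have "((\<lambda>s. 253 / 100 - 439 / 300 * exp (- (high_rate * (s - switch)))) has_real_derivative high_rate * (253 / 100 - high_phase x)) (at x)"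
        by (auto intro!: derivative_eq_intros simp: high_phase_def)
      moreover have "high_phase = (\<lambda>s. 253 / 100 - 439 / 300 * exp (- (high_rate * (s - switch))))"
        by (rule ext) (rule high_phase_def)
      ultimately show ?thesis by (simp only:)
    qed
    have "high_rate * (8 / 15) \<le> high_rate * (253 / 100 - high_phase x)"
      using high_phase_bounds[OF x] high_rate(1) by (intro mult_left_mono) auto
    then show "(high_phase has_real_derivative high_rate * (253 / 100 - high_phase x)) (at x) \<and> 1 \<le> high_rate * (253 / 100 - high_phase x)"
      using dF order.trans[OF high_rate(3)] by blast
    have "high_rate * (253 / 100 - high_phase x) \<le> 62 / 30 * (253 / 100 - high_phase x)"
      using high_phase_bounds[OF x] high_rate(4) by (intro mult_right_mono) auto
    then have "15 / 31 * (high_rate * (253 / 100 - high_phase x)) \<le> 253 / 100 - high_phase x" by simp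
    moreover have "((\<lambda>s. 3 / 2 * (7 / 10 + 10 / 31 * (high_phase s - 16 / 15))) has_real_derivative
        15 / 31 * (high_rate * (253 / 100 - high_phase x))) (at x)"
      using dF by (auto intro!: derivative_eq_intros)
    ultimately show "((\<lambda>s. 3 / 2 * (7 / 10 + 10 / 31 * (high_phase s - 16 / 15))) has_real_derivative
        15 / 31 * (high_rate * (253 / 100 - high_phase x))) (at x) \<and>
        15 / 31 * (high_rate * (253 / 100 - high_phase x)) \<le> 253 / 100 - high_phase x" by blast
  qed
  then show ?thesis
    by (subst admissible_cong[where F' = high_phase and H' = "\<lambda>s. 3 / 2 * (7 / 10 + 10 / 31 * (high_phase s - 16 / 15))"])
      (intro conjI, erule pot_schedule_up, simp only: schedule_up)
qed

lemma schedule_0: "schedule 0 = 0" and schedule_1: "schedule 1 = 1"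
proof -
  show "schedule 0 = 0" by (simp add: schedule_def low_phase_def switch_def)
  have "switch \<le> 1" by (simp add: switch_def)
  then show "schedule 1 = 1" using schedule_up[of 1] high_phase_switch(2) by simp
qed

lemma low_phase_antimono: "s \<le> t \<Longrightarrow> low_phase t \<le> low_phase s"
  using low_rate(1) by (simp add: low_phase_def)

lemma high_phase_mono: "s \<le> t \<Longrightarrow> high_phase s \<le> high_phase t"
  using high_rate(1) by (simp add: high_phase_def)

lemma schedule_mono:
  assumes "0 \<le> s" "s \<le> t" shows "schedule s \<le> schedule t"
proof -
  have low: "schedule u \<le> schedule v" if "0 \<le> u" "u \<le> v" "v \<le> switch" for u v
    using that low_phase_antimono[of u v] low_phase_bounds[of v] by (simp add: schedule_def divide_right_mono)
  have up: "schedule u \<le> schedule v" if "switch \<le> u" "u \<le> v" for u v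
    using that high_phase_mono[of u v] schedule_up[of u] schedule_up[of v] by simp
  show ?thesis
    using assms low[of s t] up[of s t] order.trans[OF low[of s switch] up[of switch t]]
    by (meson linear)
qed

lemma weights_exist:
  assumes k: "0 < k"
  obtains g :: "nat \<Rightarrow> real" where "g 0 = 1" "g k = 0" "\<And>i. i < k \<Longrightarrow> g (Suc i) \<le> g i"
    "\<And>i. i < k \<Longrightarrow> 3 / 2 * real k * (g i - g (Suc i)) + pot (g (Suc i)) \<le> 253 / 100 - 1 / (2 * real k)"
proof
  \<comment> \<open>Time is reversed: step \<open>i\<close> is the interval of length
    \<open>1 / k\<close> whose left end \<open>s\<close> is the fraction remaining after it.
    Multiplied by \<open>k\<close>, the quadratic term of admissibility becomes
    \<open>1 / (2 * k)\<close>.\<close>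
  let ?g = "\<lambda>i. schedule (real (k - i) / real k)"
  show "?g 0 = 1" "?g k = 0" using k by (simp_all add: schedule_0 schedule_1)
  fix i assume i: "i < k"
  define s where "s = real (k - Suc i) / real k"
  have t: "real (k - i) / real k = s + 1 / real k" using i by (simp add: s_def of_nat_diff field_simps)
  have s: "0 \<le> s" "s + 1 / real k \<le> 1" using i by (auto simp: s_def of_nat_diff field_simps)
  show "?g (Suc i) \<le> ?g i"
    unfolding t s_def[symmetric] using s(1) by (intro schedule_mono) auto
  have "admissible (253 / 100) (\<lambda>s. 3 / 2 * schedule s) (\<lambda>s. pot (schedule s)) 0 1"
    using admissible_join[OF admissible_low admissible_up] .
  then have "3 / 2 * schedule (s + 1 / real k) - 3 / 2 * schedule s
      \<le> (253 / 100 - pot (schedule s)) * (1 / real k) - (1 / real k)\<^sup>2 / 2"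
    using s unfolding admissible_def by (elim allE[of _ s] allE[of _ "s + 1 / real k"]) simp
  then have "real k * (3 / 2 * schedule (s + 1 / real k) - 3 / 2 * schedule s)
      \<le> real k * ((253 / 100 - pot (schedule s)) * (1 / real k) - (1 / real k)\<^sup>2 / 2)"
    by (intro mult_left_mono) auto
  also have "\<dots> = 253 / 100 - pot (schedule s) - 1 / (2 * real k)"
    using k by (simp add: field_simps power2_eq_square)
  finally have *: "real k * (3 / 2 * schedule (s + 1 / real k) - 3 / 2 * schedule s) \<le> 253 / 100 - pot (schedule s) - 1 / (2 * real k)" .
  show "3 / 2 * real k * (?g i - ?g (Suc i)) + pot (?g (Suc i)) \<le> 253 / 100 - 1 / (2 * real k)"
  proof -
    have "3 / 2 * real k * (schedule (s + 1 / real k) - schedule s) = real k * (3 / 2 * schedule (s + 1 / real k) - 3 / 2 * schedule s)"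
      by (simp add: field_simps)
    then show ?thesis unfolding t s_def[symmetric] using * by linarith
  qed
qed

section \<open>The constant against the claimed factor\<close>

lemma ln_one_minus_lower:
  assumes "0 \<le> x" "x \<le> 1 / 3"
  shows "- x - x\<^sup>2 / 2 - x ^ 3 / 2 \<le> ln (1 - x :: real)"
proof -
  let ?f = "\<lambda>x :: real. ln (1 - x) + x + x\<^sup>2 / 2 + x ^ 3 / 2"
  have "?f 0 \<le> ?f x"
  proof (rule DERIV_nonneg_imp_nondecreasing[OF assms(1)])
    fix y assume y: "0 \<le> y" "y \<le> x"
    \<comment> \<open>The coefficient \<open>1 / 2\<close> of the cube, in place of
      \<open>1 / 3\<close>, absorbs the tail of the series; the derivative stays nonnegative exactly
      up to \<open>1 / 3\<close>.\<close>
    have "(?f has_real_derivative (y\<^sup>2 * (1 - 3 * y) / 2) / (1 - y)) (at y)"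
      using y assms by (auto intro!: derivative_eq_intros simp: field_simps power2_eq_square power3_eq_cube)
    moreover have "0 \<le> (y\<^sup>2 * (1 - 3 * y) / 2) / (1 - y)" using y assms by auto
    ultimately show "\<exists>d. (?f has_real_derivative d) (at y) \<and> 0 \<le> d" by blast
  qed
  then show ?thesis by simp
qed

text \<open>\<open>k = 2\<close> is computed directly. For larger \<open>k\<close>, with
  \<open>x = 1 / (2 * k)\<close>, the logarithm bound gives \<open>(1 - x) ^ k \<ge> exp (- 1 / 2) *
  (1 - x / 4 - x\<^sup>2 / 4)\<close>, and a cubic polynomial in \<open>x \<le> 1 / 6\<close>
  remains.\<close>

lemma factor_bound:
  assumes k: "2 \<le> k"
  shows "(253 / 100 - 1 / (2 * real k)) * (1 - (1 - 1 / (2 * real k)) ^ k) \<le> 1"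
proof (cases "k = 2")
  case True
  then show ?thesis by (simp add: power2_eq_square)
next
  case False
  define x where "x = 1 / (2 * real k)"
  have x: "0 < x" "x \<le> 1 / 6" using k False by (auto simp: x_def field_simps)
  have kx: "real k = 1 / (2 * x)" using k by (simp add: x_def)
  have "- 1 / 2 - x / 4 - x\<^sup>2 / 4 = real k * (- x - x\<^sup>2 / 2 - x ^ 3 / 2)"
    using x by (simp add: kx field_simps power2_eq_square power3_eq_cube)
  also have "\<dots> \<le> real k * ln (1 - x)"
    using x by (intro mult_left_mono ln_one_minus_lower) auto
  finally have "exp (- 1 / 2 - x / 4 - x\<^sup>2 / 4) \<le> exp (real k * ln (1 - x))" by simp
  also have "\<dots> = (1 - x) ^ k"
    using x by (simp add: exp_of_nat_mult)
  finally have 1: "exp (- 1 / 2 - x / 4 - x\<^sup>2 / 4) \<le> (1 - x) ^ k" .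
  have q: "6065 / 10000 \<le> exp (- 1 / 2 :: real)"
  proof -
    have "exp (1 / 2) \<le> (10000 / 6065 :: real)"
      using exp_upper[of "1 / 2" "10000 / 6065" 3] by (simp add: eval_nat_numeral)
    then show ?thesis by (simp add: exp_minus field_simps)
  qed
  have "6065 / 10000 * (1 - x / 4 - x\<^sup>2 / 4) \<le> exp (- 1 / 2) * exp (- x / 4 - x\<^sup>2 / 4)"
  proof (rule mult_mono[OF q])
    show "1 - x / 4 - x\<^sup>2 / 4 \<le> exp (- x / 4 - x\<^sup>2 / 4)"
      using exp_ge_add_one_self[of "- x / 4 - x\<^sup>2 / 4"] by linarith
    have "x\<^sup>2 \<le> x * 1" unfolding power2_eq_square using x by (intro mult_left_mono) auto
    then show "0 \<le> 1 - x / 4 - x\<^sup>2 / 4" using x by simp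
  qed simp
  also have "\<dots> = exp (- 1 / 2 - x / 4 - x\<^sup>2 / 4)"
    by (simp add: exp_add[symmetric])
  also note 1
  finally have low: "6065 / 10000 * (1 - x / 4 - x\<^sup>2 / 4) \<le> (1 - x) ^ k" .
  have "(253 / 100 - x) * (1 - (1 - x) ^ k) \<le> (253 / 100 - x) * (1 - 6065 / 10000 * (1 - x / 4 - x\<^sup>2 / 4))"
    using low x by (intro mult_left_mono) auto
  also have "\<dots> \<le> 1"
  proof -
    have "(253 / 100 - x) * (1 - 6065 / 10000 * (1 - x / 4 - x\<^sup>2 / 4)) =
        995555 / 1000000 - 988875 / 100000000 * x + 23198625 / 100000000 * x\<^sup>2 - 151625 / 1000000 * x ^ 3"
      by (simp add: field_simps power2_eq_square power3_eq_cube)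
    moreover have "x\<^sup>2 \<le> x / 6"
      using mult_left_mono[OF x(2), of x] x by (simp add: power2_eq_square)
    \<comment> \<open>Without the cubic term the polynomial would exceed 1 at
      \<open>x = 1 / 6\<close>; a square vanishing there bounds it by lower powers.\<close>
    moreover have "x\<^sup>2 / 3 - x / 36 \<le> x ^ 3"
    proof -
      have "0 \<le> x * (x - 1 / 6)\<^sup>2" using x by simp
      also have "\<dots> = x ^ 3 - x\<^sup>2 / 3 + x / 36"
        by (simp add: field_simps power2_eq_square power3_eq_cube)
      finally show ?thesis by simp
    qed
    ultimately show ?thesis using x by linarith
  qed
  finally show ?thesis by (simp add: x_def)
qed

section \<open>From the bound on every policy to the two inequalities\<close>

theorem theorem13:
  fixes V :: "'a set" and E :: "('a \<times> 'a) set" and p :: "'a \<times> 'a \<Rightarrow> real"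
    and k :: nat and \<pi> :: "'a policy"
  assumes "ic_graph V E p"
    and "2 \<le> k" and "k \<le> card V"
    and "greedy_policy V E p k \<pi>"
  shows "spread V E p \<pi> \<ge> (1 - (1 - 1 / (2 * real k)) ^ k) * OPT_A V E p k
       \<and> (1 - (1 - 1 / (2 * real k)) ^ k) * OPT_A V E p k \<ge> (1 - 1 / sqrt (exp 1)) * OPT_A V E p k"
proof -
  interpret greedy_ic V E p k \<pi>
    using assms by unfold_locales
  let ?q = "1 - (1 - 1 / (2 * real k)) ^ k" and ?C = "253 / 100 - 1 / (2 * real k)"
  have q: "0 \<le> ?q"
    using assms(2) by (simp add: power_le_one)
  have spread_nonneg: "0 \<le> spread V E p \<pi>"
    unfolding spread_greedy by (intro sum_nonneg gain_nonneg)
  obtain g :: "nat \<Rightarrow> real" where g: "g 0 = 1" "g k = 0" "\<And>i. i < k \<Longrightarrow> g (Suc i) \<le> g i"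
    and bracket: "\<And>i. i < k \<Longrightarrow> 3 / 2 * real k * (g i - g (Suc i)) + pot (g (Suc i)) \<le> ?C"
    using weights_exist[of k] assms(2) by auto
  \<comment> \<open>The gains are nonnegative and sum to the greedy spread, so a uniform bound on
    the brackets suffices.\<close>
  have bound: "spread V E p \<pi>' \<le> ?C * spread V E p \<pi>" if "policy_size V E \<pi>' k" for \<pi>'
  proof -
    have "spread V E p \<pi>' \<le> (\<Sum>i<k. gain i * (3 / 2 * real k * (g i - g (Suc i)) + pot (g (Suc i))))"
      by (rule policy_bound[OF that potential_ok_pot _ g]) (simp add: pot_def)
    also have "\<dots> \<le> (\<Sum>i<k. gain i * ?C)"
      using bracket gain_nonneg by (intro sum_mono mult_left_mono) auto
    finally show ?thesis
      by (simp only: spread_greedy sum_distrib_right[symmetric] mult.commute)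
  qed
  define X where "X = {spread V E p \<pi>' | \<pi>'. policy_size V E \<pi>' k}"
  have OPT: "OPT_A V E p k = Sup X"
    by (simp add: OPT_A_def X_def)
  have mem: "spread V E p \<pi> \<in> X"
    using policy_size_greedy by (auto simp: X_def)
  have le: "x \<le> ?C * spread V E p \<pi>" if "x \<in> X" for x
    using that bound by (auto simp: X_def)
  have OPT_le: "OPT_A V E p k \<le> ?C * spread V E p \<pi>"
    unfolding OPT using mem le by (intro cSup_least) auto
  \<comment> \<open>Greedy is itself a competitor, and \<open>le\<close> bounds the set above. The
    resulting sign of \<open>OPT_A\<close> is what the comparison of the two factors needs.\<close>
  have "spread V E p \<pi> \<le> OPT_A V E p k"
    unfolding OPT using mem le by (intro cSup_upper bdd_aboveI) auto
  then have OPT_nonneg: "0 \<le> OPT_A V E p k"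
    using spread_nonneg by linarith
  have "?q * OPT_A V E p k \<le> ?q * (?C * spread V E p \<pi>)"
    using q OPT_le by (rule mult_left_mono[rotated])
  also have "\<dots> = (?C * ?q) * spread V E p \<pi>"
    by (simp only: mult_ac)
  also have "\<dots> \<le> 1 * spread V E p \<pi>"
    using factor_bound[OF assms(2)] spread_nonneg by (rule mult_right_mono)
  finally have first: "?q * OPT_A V E p k \<le> spread V E p \<pi>"
    by simp
  have "(1 - 1 / (2 * real k)) ^ k \<le> exp (- (1 / (2 * real k))) ^ k"
    using assms(2) exp_ge_add_one_self[of "- (1 / (2 * real k))"] by (intro power_mono) auto
  also have "\<dots> = exp (- (1 / 2))"
    using assms(2) by (simp add: exp_of_nat_mult[symmetric])
  also have "\<dots> = 1 / sqrt (exp 1)"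
  proof -
    have "sqrt (exp 1) = exp (1 / 2 :: real)"
      by (rule real_sqrt_unique) (simp_all add: exp_double[symmetric] power2_eq_square exp_add[symmetric])
    then show ?thesis by (simp add: exp_minus field_simps)
  qed
  finally have "(1 - 1 / sqrt (exp 1)) * OPT_A V E p k \<le> ?q * OPT_A V E p k"
    using OPT_nonneg by (intro mult_right_mono) auto
  with first show ?thesis by simp
qed

end
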